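(* Let $d\ge2$ and let $\mathbf{k}\in L^1(\mathbb{R}^d,\mathbb{R}^{d\times d})$ be of the form $\mathbf{k}(x)=k^\parallel(\|x\|)\,\mathrm{Pr}_x^\parallel+k^\perp(\|x\|)\,\mathrm{Pr}_x^\perp$ for $x\neq0$, with $k^\parallel,k^\perp:\mathbb{R}^+\to\mathbb{R}$. With $\mu:=\frac d2-1$, define for $\varrho>0$ $$h^\parallel(\varrho)=\frac{2\pi}{\varrho^\mu}\int_0^\infty r^{\mu+1}k^\parallel(r)J_\mu(2\pi\varrho r)\,dr-\frac{2\mu+1}{\varrho^{\mu+1}}\int_0^\infty r^{\mu}\big(k^\parallel(r)-k^\perp(r)\big)J_{\mu+1}(2\pi\varrho r)\,dr,$$ $$h^\perp(\varrho)=\frac{2\pi}{\varrho^\mu}\int_0^\infty r^{\mu+1}k^\perp(r)J_\mu(2\pi\varrho r)\,dr+\frac{1}{\varrho^{\mu+1}}\int_0^\infty r^{\mu}\big(k^\parallel(r)-k^\perp(r)\big)J_{\mu+1}(2\pi\varrho r)\,dr.$$ Then (by Bochner's theorem) $\mathbf{k}$ is positive definite, i.e. it is a kernel, if and only if $h^\parallel$ and $h^\perp$ are nonnegative functions.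
   Context: $\mathbb{R}^+=(0,\infty)$. For $x\in\mathbb{R}^d\setminus\{0\}$, $\mathrm{Pr}_x^\parallel:=xx^T/\|x\|^2$ and $\mathrm{Pr}_x^\perp:=\mathbb{I}_d-xx^T/\|x\|^2$, where $\mathbb{I}_d$ is the $d\times d$ identity matrix. The Fourier transform is entrywise, $\widehat f(\xi)=\int_{\mathbb{R}^d}f(x)e^{-2\pi i x\cdot\xi}\,dx$. $J_\nu$ is the Bessel function of the first kind of order $\nu$. The function $\mathbf{k}$ is called positive definite if $\sum_{a,b=1}^N\alpha_a\cdot\mathbf{k}(x_a-x_b)\alpha_b\ge0$ for all $N\in\mathbb{N}$, $x_1,\dots,x_N\in\mathbb{R}^d$, $\alpha_1,\dots,\alpha_N\in\mathbb{R}^d$. A kernel is a positive definite function $K:\mathbb{R}^d\times\mathbb{R}^d\to\mathbb{R}^{d\times d}$ with $K(y,x)=K(x,y)^T$; here $K(x,y)=\mathbf{k}(x-y)$. The functions $h^\parallel,h^\perp$ are the coefficients of the Fourier transform: $\widehat{\mathbf{k}}(\xi)=h^\parallel(\|\xi\|)\mathrm{Pr}_\xi^\parallel+h^\perp(\|\xi\|)\mathrm{Pr}_\xi^\perp$ for $\xi\ne0$.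
   Formalization: The "if" direction and the equivalence with being a kernel are stated for continuous k, as Bochner's theorem needs; without continuity they fail (k(x)=exp(-|x|²)I for x≠0, k(0)=-I). "Positive definite implies h∥, h⊥ nonnegative" is stated for all L¹ k. *)

theory Defs
  imports "HOL-Analysis.Analysis"
begin

definition proj_par :: "real ^ 'd \<Rightarrow> real ^ 'd ^ 'd"
  where "proj_par x = (1 / (norm x)\<^sup>2) *\<^sub>R (\<chi> i j. x $ i * x $ j)"

definition proj_perp :: "real ^ 'd \<Rightarrow> real ^ 'd ^ 'd"
  where "proj_perp x = mat 1 - proj_par x"

(* Bessel function of the first kind, for real order and positive argument.
   At x = 0 the value for order 0 is not the usual one, since 0 powr 0 = 0. *)
definition bessel_J :: "real \<Rightarrow> real \<Rightarrow> real"
  where "bessel_J \<nu> x =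
    (x / 2) powr \<nu> * (\<Sum>m. (-1) ^ m / fact m * rGamma (real m + \<nu> + 1) * (x / 2) ^ (2 * m))"

(* The points x a need not be distinct, and the vectors are real. *)
definition positive_definite :: "(real ^ 'd \<Rightarrow> real ^ 'd ^ 'd) \<Rightarrow> bool"
  where "positive_definite k \<longleftrightarrow>
    (\<forall>N. \<forall>x \<alpha> :: nat \<Rightarrow> real ^ 'd.
      (\<Sum>a<N. \<Sum>b<N. \<alpha> a \<bullet> (k (x a - x b) *v \<alpha> b)) \<ge> 0)"

definition is_kernel :: "(real ^ 'd \<Rightarrow> real ^ 'd \<Rightarrow> real ^ 'd ^ 'd) \<Rightarrow> bool"
  where "is_kernel K \<longleftrightarrow>
    (\<forall>N. \<forall>x \<alpha> :: nat \<Rightarrow> real ^ 'd.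
      (\<Sum>a<N. \<Sum>b<N. \<alpha> a \<bullet> (K (x a) (x b) *v \<alpha> b)) \<ge> 0) \<and>
    (\<forall>x y. K y x = transpose (K x y))"

end

theory Submission
  imports Defs "HOL-Probability.Probability"
begin

text \<open>
  Writing \<open>hpar\<close> and \<open>hperp\<close> as the coefficients of the Fourier transform amounts to two spherical
  integrals of \<open>cos (t \<omega>\<^sub>1)\<close>, with weights \<open>1\<close> and \<open>\<omega>\<^sub>2\<^sup>2\<close>. Expanding the cosine, the moments of
  the sphere are read off from Gaussian moments in polar coordinates, and the resulting power series
  are those of \<open>J\<^sub>\<mu>\<close> and \<open>J\<^sub>\<mu>\<^sub>+\<^sub>1\<close>. The remaining entry, with weight \<open>\<omega>\<^sub>1\<^sup>2\<close>, follows from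
  \<open>|\<omega>|\<^sup>2 = 1\<close>, and mixed entries vanish by reflection.

  If \<open>k\<close> is positive definite, but only measurable, its Fourier transform is nonnegative because
  the defining sum may be averaged over independent Gaussian points: the diagonal terms are of lower
  order in the number of points. Conversely, for continuous \<open>k\<close>, mollification by a Gaussian, which
  is itself the Fourier transform of a positive function, exhibits \<open>k\<close> as a pointwise limit of
  positive definite functions.
\<close>

section \<open>Gaussian integrals\<close>

text \<open>The hypotheses do not fix \<open>k 0\<close>. Taking \<open>k 0\<close> to be minus the
  identity and \<open>k\<close> zero elsewhere makes both coefficients vanish and destroys positive
  definiteness, so nonnegative coefficients can give positive definiteness only for continuous
  \<open>k\<close>; the opposite implication holds for every integrable \<open>k\<close> of radial
  form. For the same reason sums over points cannot simply be turned into integrals: what is known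
  almost everywhere says nothing on the diagonal. Random points help because the differences of
  distinct ones almost surely avoid any given null set. Since \<open>k\<close> is even, its
  transform is a real cosine integral, and matrix statements are tested through the scalar functions
  \<open>w \<bullet> (k x *v w)\<close>. Frequencies are rotated onto a coordinate axis; the factor
  \<open>2 * \<mu> + 1\<close>, which is d - 1, counts the axes orthogonal to it. The profiles
  \<open>kpar\<close> and \<open>kperp\<close> carry no measurability of their own, so they are
  recovered from \<open>k\<close> and replaced by Borel representatives before Fubini is
  used.\<close>

lemma lborel_prod_Basis:
  fixes f :: "'a::euclidean_space \<Rightarrow> real \<Rightarrow> 'c::{real_normed_field,banach,second_countable_topology}"
  assumes f: "\<And>b. b \<in> Basis \<Longrightarrow> integrable lborel (f b)"
  shows integrable_lborel_prod_Basis: "integrable lborel (\<lambda>x::'a. \<Prod>b\<in>Basis. f b (x \<bullet> b))"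
    and integral_lborel_prod_Basis:
      "(LINT x|lborel. (\<Prod>b\<in>Basis. f b (x \<bullet> b))) = (\<Prod>b\<in>Basis. LINT t|lborel. f b t)"
proof -
  interpret product_sigma_finite "\<lambda>_::'a. lborel :: real measure" ..
  have meas[measurable]: "(\<lambda>x::'a. \<Prod>b\<in>Basis. f b (x \<bullet> b)) \<in> borel_measurable borel"
  proof (rule borel_measurable_prod)
    fix b :: 'a assume "b \<in> Basis"
    then have [measurable]: "f b \<in> borel_measurable borel" using f[of b] by simp
    show "(\<lambda>x. f b (x \<bullet> b)) \<in> borel_measurable borel" by measurable
  qed
  \<comment> \<open>By \<open>lborel_eq\<close> the measure \<open>lborel\<close> is the image of a
    product of one-dimensional Lebesgue measures under this map, so both claims become statements
    about product spaces.\<close>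
  have map[measurable]: "(\<lambda>g. \<Sum>b\<in>Basis. g b *\<^sub>R b) \<in> (\<Pi>\<^sub>M b\<in>Basis. lborel) \<rightarrow>\<^sub>M (borel :: 'a measure)"
    by measurable
  have eq: "(\<Prod>b\<in>Basis. f b ((\<Sum>c\<in>Basis. g c *\<^sub>R c) \<bullet> b)) = (\<Prod>b\<in>Basis. f b (g b))" for g :: "'a \<Rightarrow> real"
    by (intro prod.cong) (auto simp: inner_sum_left_Basis)
  show "integrable lborel (\<lambda>x::'a. \<Prod>b\<in>Basis. f b (x \<bullet> b))"
    apply (subst lborel_eq, subst integrable_distr_eq[OF map])
    by (auto simp: eq intro!: product_integrable_prod f)
  show "(LINT x|lborel. (\<Prod>b\<in>Basis. f b (x \<bullet> b))) = (\<Prod>b\<in>Basis. LINT t|lborel. f b t)"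
    apply (subst lborel_eq, subst integral_distr[OF map])
    by (auto simp: eq intro!: product_integral_prod f)
qed

text \<open>Kept as a product over the basis so that integrals factor; \<open>gauss_eq\<close>
  supplies the radial form.\<close>

definition gauss :: "'a::euclidean_space \<Rightarrow> real"
  where "gauss x = (\<Prod>b\<in>Basis. std_normal_density (x \<bullet> b))"

lemma gauss_eq: "gauss (x::'a::euclidean_space) = (1 / sqrt (2 * pi)) ^ DIM('a) * exp (- (norm x)\<^sup>2 / 2)"
proof -
  have "(norm x)\<^sup>2 = (\<Sum>b\<in>Basis. (x \<bullet> b)\<^sup>2)"
    unfolding power2_norm_eq_inner by (subst euclidean_inner) (simp add: power2_eq_square)
  then have "exp (- (norm x)\<^sup>2 / 2) = (\<Prod>b\<in>Basis. exp (- (x \<bullet> b)\<^sup>2 / 2))"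
    by (simp add: exp_sum[symmetric] sum_negf sum_divide_distrib)
  then show ?thesis
    unfolding gauss_def std_normal_density_def by (simp add: prod.distrib power_one_over prod_dividef)
qed

lemma gauss_pos: "gauss x > 0"
  unfolding gauss_eq by simp

lemma gauss_nonneg: "gauss x \<ge> 0"
  using gauss_pos[of x] by simp

lemma gauss_borel[measurable]: "gauss \<in> borel_measurable borel"
  unfolding gauss_eq[abs_def] by measurable

lemma gauss_minus: "gauss (- x) = gauss x"
  by (simp add: gauss_eq)

lemma integrable_gauss: "integrable lborel (gauss :: 'a::euclidean_space \<Rightarrow> real)"
  unfolding gauss_def[abs_def]
  by (intro integrable_lborel_prod_Basis integrable_normal_density) simp

lemma integral_gauss: "(LINT x|lborel. gauss (x::'a::euclidean_space)) = 1"
  unfolding gauss_def[abs_def]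
  by (subst integral_lborel_prod_Basis) (auto intro: integrable_normal_density)

text \<open>Coordinatewise this is the characteristic function of the standard normal law; the
  complex product is formed first and its real part taken at the end. Up to a constant the Gaussian
  is thus its own Fourier transform.\<close>

lemma integral_gauss_cos:
  fixes y :: "'a::euclidean_space"
  shows "(LINT x|lborel. gauss x * cos (x \<bullet> y)) = exp (- (norm y)\<^sup>2 / 2)"
proof -
  define f where "f b t = complex_of_real (std_normal_density t) * iexp (t * (y \<bullet> b))" for b :: 'a and t
  have int: "integrable lborel (f b)" for b
  proof (rule Bochner_Integration.integrable_bound)
    show "integrable lborel std_normal_density" by (simp add: integrable_normal_density)
  qed (auto simp: f_def[abs_def] norm_mult)
  have fv: "(LINT t|lborel. f b t) = exp (- complex_of_real ((y \<bullet> b)\<^sup>2) / 2)" for b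
  proof -
    have "char std_normal_distribution (y \<bullet> b) = (LINT t|lborel. f b t)"
      unfolding char_def f_def
      by (subst integral_density) (auto simp: scaleR_conv_of_real mult.commute)
    then show ?thesis by (simp add: char_std_normal_distribution exp_of_real[symmetric])
  qed
  have eq: "(\<Prod>b\<in>Basis. f b (x \<bullet> b)) = complex_of_real (gauss x) * iexp (x \<bullet> y)" for x
    unfolding f_def gauss_def
    by (subst euclidean_inner[of x y]) (simp add: prod.distrib exp_sum sum_distrib_left)
  have I: "integrable lborel (\<lambda>x. complex_of_real (gauss x) * iexp (x \<bullet> y))"
    using integrable_lborel_prod_Basis[of f, OF int] unfolding eq .
  have "(LINT x|lborel. complex_of_real (gauss x) * iexp (x \<bullet> y)) = (\<Prod>b\<in>Basis. LINT t|lborel. f b t)"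
    using integral_lborel_prod_Basis[of f, OF int] unfolding eq .
  also have "\<dots> = complex_of_real (exp (- (norm y)\<^sup>2 / 2))"
  proof -
    have "(norm y)\<^sup>2 = (\<Sum>b\<in>Basis. (y \<bullet> b)\<^sup>2)"
      unfolding power2_norm_eq_inner by (subst euclidean_inner) (simp add: power2_eq_square)
    then show ?thesis
      unfolding fv by (simp add: exp_sum[symmetric] exp_of_real[symmetric] sum_negf sum_divide_distrib)
  qed
  finally have "Re (LINT x|lborel. complex_of_real (gauss x) * iexp (x \<bullet> y)) = exp (- (norm y)\<^sup>2 / 2)"
    by simp
  moreover have "Re (LINT x|lborel. complex_of_real (gauss x) * iexp (x \<bullet> y)) =
    (LINT x|lborel. gauss x * cos (x \<bullet> y))"
    by (subst integral_Re[OF I, symmetric]) (simp add: Re_exp)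
  ultimately show ?thesis by simp
qed

lemma lborel_scaleR:
  fixes F :: "'a::euclidean_space \<Rightarrow> real"
  assumes "c > 0" and [measurable]: "F \<in> borel_measurable borel"
  shows integrable_scaleR: "integrable lborel F \<Longrightarrow> integrable lborel (\<lambda>x. F (c *\<^sub>R x))"
    and integral_scaleR: "(LINT x|lborel. F (c *\<^sub>R x)) = (LINT x|lborel. F x) / c ^ DIM('a)"
proof -
  have eq: "lborel = density (distr lborel borel (\<lambda>x::'a. c *\<^sub>R x)) (\<lambda>_. c ^ DIM('a))"
    using lborel_affine[of c "0::'a"] assms by simp
  have "integrable (density (distr lborel borel (\<lambda>x::'a. c *\<^sub>R x)) (\<lambda>_. c ^ DIM('a))) F
      \<longleftrightarrow> integrable lborel (\<lambda>x. F (c *\<^sub>R x))"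
    using assms by (subst integrable_density) (auto simp: integrable_distr_eq)
  then show "integrable lborel F \<Longrightarrow> integrable lborel (\<lambda>x. F (c *\<^sub>R x))" using eq by simp
  have "integral\<^sup>L (density (distr lborel borel (\<lambda>x::'a. c *\<^sub>R x)) (\<lambda>_. c ^ DIM('a))) F
     = c ^ DIM('a) * (LINT x|lborel. F (c *\<^sub>R x))"
    using assms by (subst integral_density) (auto simp: integral_distr)
  then show "(LINT x|lborel. F (c *\<^sub>R x)) = (LINT x|lborel. F x) / c ^ DIM('a)"
    using eq assms by (simp add: field_simps)
qed

lemma lborel_integral_reflect:
  fixes F :: "'a::euclidean_space \<Rightarrow> 'b::{banach,second_countable_topology}"
  assumes [measurable]: "F \<in> borel_measurable borel"
  shows "(LINT x|lborel. F (t - x)) = (LINT x|lborel. F x)"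
    and "integrable lborel (\<lambda>x. F (t - x)) \<longleftrightarrow> integrable lborel F"
proof -
  have eq: "lborel = distr lborel borel (\<lambda>x::'a. t - x)"
    using lborel_affine[of "-1" t] by (simp add: density_1)
  have "integral\<^sup>L (distr lborel borel (\<lambda>x::'a. t - x)) F = (LINT x|lborel. F (t - x))"
    by (subst integral_distr) auto
  then show "(LINT x|lborel. F (t - x)) = (LINT x|lborel. F x)" using eq by simp
  have "integrable (distr lborel borel (\<lambda>x::'a. t - x)) F = integrable lborel (\<lambda>x. F (t - x))"
    by (subst integrable_distr_eq) auto
  then show "integrable lborel (\<lambda>x. F (t - x)) \<longleftrightarrow> integrable lborel F" using eq by simp
qed

section \<open>Scalar positive definite functions\<close>

definition pos_def_fun :: "('a::real_vector \<Rightarrow> real) \<Rightarrow> bool"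
  where "pos_def_fun q \<longleftrightarrow>
    (\<forall>N. \<forall>x :: nat \<Rightarrow> 'a. \<forall>c :: nat \<Rightarrow> real. (\<Sum>a<N. \<Sum>b<N. c a * c b * q (x a - x b)) \<ge> 0)"

text \<open>For fixed x the map y to x - y preserves Lebesgue measure, so the bad y form a null set
  for \<open>lborel\<close> and hence for \<open>M\<close>; Fubini then treats the pair. The bad set
  is first enlarged to a measurable null set, since \<open>P\<close> itself may fail to be
  measurable.\<close>

lemma AE_diff_lborel:
  fixes P :: "'a::euclidean_space \<Rightarrow> bool"
  assumes "AE z in lborel. P z" "prob_space M" "absolutely_continuous lborel M" "sets M = sets borel"
  shows "AE (x, y) in M \<Otimes>\<^sub>M M. P (x - y)"
proof -
  interpret M: prob_space M by fact
  interpret MM: pair_prob_space M M ..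
  from AE_E[OF assms(1)] obtain N where N: "{z \<in> space lborel. \<not> P z} \<subseteq> N" "emeasure lborel N = 0" "N \<in> sets lborel" by blast
  note [measurable] = N(3)[simplified]
  have sM[measurable_cong]: "sets M = sets borel" by fact
  have "AE x in M. AE y in M. x - y \<notin> N"
  proof (rule AE_I2)
    fix x
    have "AE y in lborel. x - y \<notin> N"
    proof -
      have "AE y in distr lborel borel (\<lambda>y. x - y). y \<notin> N"
        using lborel_affine[of "-1" x] N by (intro AE_not_in) (simp add: null_sets_def density_1)
      then show ?thesis by (subst (asm) AE_distr_iff) auto
    qed
    then show "AE y in M. x - y \<notin> N"
      using absolutely_continuous_AE[OF _ assms(3)] assms(4) by auto
  qed
  moreover have "Measurable.pred (borel \<Otimes>\<^sub>M borel) (\<lambda>z::'a \<times> 'a. fst z - snd z \<notin> N)"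
    by measurable
  then have "{z::'a \<times> 'a. case z of (x, y) \<Rightarrow> x - y \<notin> N} \<in> sets (borel \<Otimes>\<^sub>M borel)"
    by (simp add: pred_def space_pair_measure split_beta')
  ultimately have "AE z in M \<Otimes>\<^sub>M M. (case z of (x,y) \<Rightarrow> x - y \<notin> N)"
    using sM by (intro MM.AE_pair_measure) (auto simp: space_pair_measure sets_eq_imp_space_eq[OF sM] cong: sets_pair_measure_cong)
  then show ?thesis by (rule eventually_mono) (use N(1) in auto)
qed

lemma iid_pair:
  fixes M :: "'a measure"
  assumes "prob_space M" "i \<noteq> (j::nat)"
  shows "distr (PiM UNIV (\<lambda>_::nat. M)) (M \<Otimes>\<^sub>M M) (\<lambda>\<omega>. (\<omega> i, \<omega> j)) = M \<Otimes>\<^sub>M M"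
proof -
  interpret M: prob_space M by fact
  interpret product_prob_space "\<lambda>_::nat. M" UNIV ..
  have [measurable]: "(\<lambda>\<omega>. (\<omega> i, \<omega> j)) \<in> PiM UNIV (\<lambda>_::nat. M) \<rightarrow>\<^sub>M M \<Otimes>\<^sub>M M"
    by measurable
  have "M \<Otimes>\<^sub>M M = distr (PiM UNIV (\<lambda>_::nat. M)) (M \<Otimes>\<^sub>M M) (\<lambda>\<omega>. (\<omega> i, \<omega> j))"
  proof (rule pair_measure_eqI)
    fix A B assume AB[measurable]: "A \<in> sets M" "B \<in> sets M"
    let ?X = "\<lambda>k. if k = i then A else B"
    have "emeasure (PiM UNIV (\<lambda>_::nat. M)) {\<omega> \<in> space (PiM UNIV (\<lambda>_::nat. M)). \<forall>k\<in>{i, j}. \<omega> k \<in> ?X k}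
        = (\<Prod>k\<in>{i, j}. emeasure M (?X k))"
      using AB by (intro emeasure_PiM_Collect) auto
    also have "\<dots> = emeasure M A * emeasure M B" using assms(2) by simp
    also have "{\<omega> \<in> space (PiM UNIV (\<lambda>_::nat. M)). \<forall>k\<in>{i, j}. \<omega> k \<in> ?X k}
       = (\<lambda>\<omega>. (\<omega> i, \<omega> j)) -` (A \<times> B) \<inter> space (PiM UNIV (\<lambda>_::nat. M))"
      using assms(2) by auto
    finally show "emeasure M A * emeasure M B =
       emeasure (distr (PiM UNIV (\<lambda>_::nat. M)) (M \<Otimes>\<^sub>M M) (\<lambda>\<omega>. (\<omega> i, \<omega> j))) (A \<times> B)"
      by (simp add: emeasure_distr)
  qed (auto intro: M.sigma_finite_measure_axioms)
  then show ?thesis by simp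
qed


text \<open>Positive definiteness constrains \<open>q\<close> pointwise, while the integral sees
  only \<open>q'\<close>. For n + 1 independent points with law \<open>M\<close>, the off-diagonal
  part of the sum has expectation n(n + 1) times the integral, and the diagonal adds at most (n +
  1)|q 0|. Hence the integral is at least -|q 0|/n for every positive n.\<close>

lemma pos_def_fun_average:
  fixes q q' c :: "'a::euclidean_space \<Rightarrow> real"
  assumes q: "pos_def_fun q" and ae: "AE z in lborel. q z = q' z"
    and M: "prob_space M" "absolutely_continuous lborel M" "sets M = sets borel"
    and c: "\<And>x. \<bar>c x\<bar> \<le> 1"
    and int: "integrable (M \<Otimes>\<^sub>M M) (\<lambda>(x, y). c x * c y * q' (x - y))"
  shows "0 \<le> integral\<^sup>L (M \<Otimes>\<^sub>M M) (\<lambda>(x, y). c x * c y * q' (x - y))" (is "0 \<le> ?I")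
proof -
  interpret M: prob_space M by fact
  interpret product_prob_space "\<lambda>_::nat. M" UNIV ..
  let ?P = "PiM UNIV (\<lambda>_::nat. M)"
  define F where "F \<omega> a b = c (\<omega> a) * c (\<omega> b) * q' (\<omega> a - \<omega> b)" for \<omega> :: "nat \<Rightarrow> 'a" and a b
  have [measurable]: "(\<lambda>\<omega>. (\<omega> i, \<omega> j)) \<in> ?P \<rightarrow>\<^sub>M M \<Otimes>\<^sub>M M" for i j :: nat
    by measurable
  have FI: "has_bochner_integral ?P (\<lambda>\<omega>. F \<omega> a b) ?I" if "a \<noteq> b" for a b
  proof -
    have F: "(\<lambda>\<omega>. F \<omega> a b) = (\<lambda>\<omega>. (case (\<omega> a, \<omega> b) of (x, y) \<Rightarrow> c x * c y * q' (x - y)))"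
      by (simp add: F_def)
    have m: "(\<lambda>(x, y). c x * c y * q' (x - y)) \<in> borel_measurable (M \<Otimes>\<^sub>M M)"
      using int by (rule borel_measurable_integrable)
    have "integrable (distr ?P (M \<Otimes>\<^sub>M M) (\<lambda>\<omega>. (\<omega> a, \<omega> b))) (\<lambda>(x, y). c x * c y * q' (x - y))"
      using int by (simp add: iid_pair[OF M(1) that])
    then have 1: "integrable ?P (\<lambda>\<omega>. F \<omega> a b)"
      by (subst (asm) integrable_distr_eq[OF _ m]) (auto simp: F)
    have "integral\<^sup>L (distr ?P (M \<Otimes>\<^sub>M M) (\<lambda>\<omega>. (\<omega> a, \<omega> b))) (\<lambda>(x, y). c x * c y * q' (x - y)) = ?I"
      by (simp add: iid_pair[OF M(1) that])
    then have "(LINT \<omega>|?P. F \<omega> a b) = ?I"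
      by (subst (asm) integral_distr[OF _ m]) (auto simp: F)
    with 1 show ?thesis by (simp add: has_bochner_integral_iff)
  qed
  have AE1: "AE \<omega> in ?P. a \<noteq> b \<longrightarrow> q (\<omega> a - \<omega> b) = q' (\<omega> a - \<omega> b)" for a b
  proof (cases "a = b")
    case False
    have "AE (x, y) in distr ?P (M \<Otimes>\<^sub>M M) (\<lambda>\<omega>. (\<omega> a, \<omega> b)). q (x - y) = q' (x - y)"
      unfolding iid_pair[OF M(1) False] by (rule AE_diff_lborel[OF ae M])
    then have "AE \<omega> in ?P. (case (\<omega> a, \<omega> b) of (x, y) \<Rightarrow> q (x - y) = q' (x - y))"
      by (rule AE_distrD[rotated]) measurable
    then show ?thesis by auto
  qed auto
  \<comment> \<open>Only countably many pairs of indices occur, so one null set of sample sequences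
    serves for every number of points.\<close>
  have AE2: "AE \<omega> in ?P. \<forall>a b. a \<noteq> b \<longrightarrow> q (\<omega> a - \<omega> b) = q' (\<omega> a - \<omega> b)"
    using AE1 by (simp add: AE_all_countable)
  have bound: "- (real N * \<bar>q 0\<bar>) \<le> (\<Sum>a<N. \<Sum>b\<in>{..<N} - {a}. F \<omega> a b)"
    if "\<forall>a b. a \<noteq> b \<longrightarrow> q (\<omega> a - \<omega> b) = q' (\<omega> a - \<omega> b)" for \<omega> N
  proof -
    have "0 \<le> (\<Sum>a<N. \<Sum>b<N. c (\<omega> a) * c (\<omega> b) * q (\<omega> a - \<omega> b))"
      using q unfolding pos_def_fun_def by (elim allE[of _ N] allE[of _ \<omega>] allE[of _ "\<lambda>a. c (\<omega> a)"])
    also have "\<dots> = (\<Sum>a<N. c (\<omega> a) * c (\<omega> a) * q 0 + (\<Sum>b\<in>{..<N} - {a}. F \<omega> a b))"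
      by (intro sum.cong refl, subst sum.remove[of _ a for a]) (auto simp: F_def that intro!: sum.cong)
    also have "\<dots> \<le> (\<Sum>a<N. \<bar>q 0\<bar> + (\<Sum>b\<in>{..<N} - {a}. F \<omega> a b))"
    proof (intro sum_mono add_right_mono)
      fix a
      have "c (\<omega> a) * c (\<omega> a) \<le> 1"
        using c[of "\<omega> a"] abs_square_le_1[of "c (\<omega> a)"] by (simp add: power2_eq_square)
      then have "c (\<omega> a) * c (\<omega> a) * \<bar>q 0\<bar> \<le> 1 * \<bar>q 0\<bar>" by (intro mult_right_mono) auto
      moreover have "c (\<omega> a) * c (\<omega> a) * q 0 \<le> c (\<omega> a) * c (\<omega> a) * \<bar>q 0\<bar>"
        by (intro mult_left_mono) auto
      ultimately show "c (\<omega> a) * c (\<omega> a) * q 0 \<le> \<bar>q 0\<bar>" by simp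
    qed
    finally show ?thesis by (simp add: sum.distrib)
  qed
  have ineq: "- \<bar>q 0\<bar> \<le> real n * ?I" for n
  proof -
    \<comment> \<open>Each of the n + 1 points has n partners, so a factor n survives the division
      by the number of points.\<close>
    let ?N = "Suc n"
    have sumI: "has_bochner_integral ?P (\<lambda>\<omega>. \<Sum>a<?N. \<Sum>b\<in>{..<?N} - {a}. F \<omega> a b)
        (\<Sum>a<?N. \<Sum>b\<in>{..<?N} - {a}. ?I)"
      by (intro has_bochner_integral_sum FI) auto
    then have eq: "(LINT \<omega>|?P. (\<Sum>a<?N. \<Sum>b\<in>{..<?N} - {a}. F \<omega> a b)) = real ?N * (real n * ?I)"
      by (auto simp: has_bochner_integral_iff)
    have "AE \<omega> in ?P. - (real ?N * \<bar>q 0\<bar>) \<le> (\<Sum>a<?N. \<Sum>b\<in>{..<?N} - {a}. F \<omega> a b)"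
      using AE2 by (rule eventually_mono) (rule bound)
    then have "(LINT \<omega>|?P. - (real ?N * \<bar>q 0\<bar>)) \<le> (LINT \<omega>|?P. (\<Sum>a<?N. \<Sum>b\<in>{..<?N} - {a}. F \<omega> a b))"
      using sumI by (intro integral_mono_AE) (simp_all only: has_bochner_integral_iff integrable_const P.emeasure_space_1 simp_thms)
    then have "real ?N * (- \<bar>q 0\<bar>) \<le> real ?N * (real n * ?I)"
      unfolding eq by (simp add: P.prob_space)
    then show ?thesis
      by (subst (asm) mult_le_cancel_left_pos) auto
  qed
  show ?thesis
  proof (rule ccontr)
    assume neg: "\<not> 0 \<le> ?I"
    then obtain n where "\<bar>q 0\<bar> < real n * (- ?I)"
      using reals_Archimedean3[of "- ?I"] by auto
    with ineq[of n] show False by simp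
  qed
qed

section \<open>Gaussian averages of functions of a difference\<close>

lemma integrable_lborel_times:
  fixes f :: "'a::euclidean_space \<Rightarrow> real" and g :: "'b::euclidean_space \<Rightarrow> real"
  assumes "integrable lborel f" "integrable lborel g"
  shows "integrable (lborel \<Otimes>\<^sub>M lborel) (\<lambda>(x, y). f x * g y)"
proof (rule lborel_pair.Fubini_integrable)
  have [measurable]: "f \<in> borel_measurable borel" "g \<in> borel_measurable borel" using assms by auto
  show "(\<lambda>(x, y). f x * g y) \<in> borel_measurable (lborel \<Otimes>\<^sub>M lborel)" by measurable
qed (use assms in \<open>auto simp: abs_mult\<close>)

lemma gauss_le: "gauss (x::'a::euclidean_space) \<le> gauss (0::'a)"
  unfolding gauss_eq by (intro mult_left_mono) auto

text \<open>Completing the square about the midpoint: |x|^2 + |x - z|^2 = 2|x - z/2|^2 + |z|^2/2.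
  The remaining Gaussian is dilated by sqrt 2, whence the power of sqrt 2 in the
  denominator.\<close>

lemma integral_gauss_gauss:
  fixes z :: "'a::euclidean_space"
  shows "(LINT x|lborel. gauss x * gauss (x - z)) = gauss (0::'a) / sqrt 2 ^ DIM('a) * exp (- (norm z)\<^sup>2 / 4)"
proof -
  have eq: "gauss x * gauss (x - z) = gauss (0::'a) * exp (- (norm z)\<^sup>2 / 4) * gauss (sqrt 2 *\<^sub>R (x - z /\<^sub>R 2))" for x
  proof -
    have "(norm x)\<^sup>2 + (norm (x - z))\<^sup>2 = (norm (sqrt 2 *\<^sub>R (x - z /\<^sub>R 2)))\<^sup>2 + (norm z)\<^sup>2 / 2"
      unfolding norm_scaleR power_mult_distrib power2_norm_eq_inner
      by (simp add: inner_diff inner_commute algebra_simps)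
    then have "exp (- (norm x)\<^sup>2 / 2) * exp (- (norm (x - z))\<^sup>2 / 2)
      = exp (- (norm z)\<^sup>2 / 4) * exp (- (norm (sqrt 2 *\<^sub>R (x - z /\<^sub>R 2)))\<^sup>2 / 2)"
      unfolding exp_add[symmetric] by (intro arg_cong[where f = exp]) (simp add: field_simps)
    then show ?thesis unfolding gauss_eq by (simp add: algebra_simps)
  qed
  have sym: "gauss (sqrt 2 *\<^sub>R (x - z /\<^sub>R 2)) = gauss (sqrt 2 *\<^sub>R (z /\<^sub>R 2 - x))" for x
    by (metis gauss_minus scaleR_minus_right minus_diff_eq)
  have "(LINT x|lborel. gauss (sqrt 2 *\<^sub>R (x - z /\<^sub>R 2))) = (LINT x|lborel. gauss (sqrt 2 *\<^sub>R (x::'a)))"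
    using lborel_integral_reflect(1)[of "\<lambda>x. gauss (sqrt 2 *\<^sub>R x)" "z /\<^sub>R 2"]
    unfolding sym by simp
  also have "\<dots> = 1 / sqrt 2 ^ DIM('a)"
    by (subst integral_scaleR) (auto simp: integral_gauss)
  finally show ?thesis unfolding eq by simp
qed

text \<open>Substituting z = x - y for fixed x and swapping the integrals leaves the autocorrelation
  of the Gaussian as the weight of \<open>Q\<close>. As \<open>Q\<close> is merely integrable,
  absolute convergence comes from bounding one Gaussian factor by \<open>gauss 0\<close> and
  integrating the other.\<close>

lemma gauss_average:
  fixes Q :: "'a::euclidean_space \<Rightarrow> real"
  assumes Q: "integrable lborel Q"
  shows integrable_gauss_average:
      "integrable (lborel \<Otimes>\<^sub>M lborel) (\<lambda>(x, y). gauss x * gauss y * Q (x - y))"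
    and integral_gauss_average:
      "integral\<^sup>L (lborel \<Otimes>\<^sub>M lborel) (\<lambda>(x, y). gauss x * gauss y * Q (x - y))
        = gauss (0::'a) / sqrt 2 ^ DIM('a) * (LINT z|lborel. exp (- (norm z)\<^sup>2 / 4) * Q z)"
proof -
  have [measurable]: "Q \<in> borel_measurable borel" using Q by auto
  define h where "h x z = gauss x * gauss (x - z) * Q z" for x z
  have h[measurable]: "(\<lambda>(x, z). h x z) \<in> borel_measurable (lborel \<Otimes>\<^sub>M lborel)"
    unfolding h_def by measurable
  have hle: "norm (h x z) \<le> norm (gauss x * (gauss (0::'a) * Q z))" for x z
    unfolding h_def norm_mult using gauss_le[of "x - z"] gauss_nonneg[of "x - z"]
    by (auto simp: mult.assoc intro!: mult_left_mono mult_right_mono)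
  have hint: "integrable (lborel \<Otimes>\<^sub>M lborel) (\<lambda>(x, z). h x z)"
    by (rule Bochner_Integration.integrable_bound[OF integrable_lborel_times[of gauss "\<lambda>z. gauss (0::'a) * Q z"]])
      (use Q hle in \<open>auto intro: integrable_gauss\<close>)
  have hx: "integrable lborel (h x)" for x
    by (rule Bochner_Integration.integrable_bound[of lborel "\<lambda>z. gauss x * (gauss (0::'a) * Q z)"])
      (use Q hle in \<open>auto simp: h_def[abs_def]\<close>)
  have hF: "h x (x - y) = gauss x * gauss y * Q (x - y)" for x y
    by (simp add: h_def)
  have [measurable]: "h x \<in> borel_measurable borel" for x unfolding h_def[abs_def] by measurable
  show I: "integrable (lborel \<Otimes>\<^sub>M lborel) (\<lambda>(x, y). gauss x * gauss y * Q (x - y))"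
  proof (rule lborel_pair.Fubini_integrable)
    have "(LINT y|lborel. norm (h x (x - y))) = (LINT z|lborel. norm (h x z))" for x
      by (rule lborel_integral_reflect) measurable
    then show "integrable lborel (\<lambda>x. LINT y|lborel. norm (case (x, y) of (x, y) \<Rightarrow> gauss x * gauss y * Q (x - y)))"
      using lborel_pair.integrable_fst'[OF integrable_norm[OF hint]] by (simp add: hF)
    have "integrable lborel (\<lambda>y. h x (x - y))" for x
      using hx by (subst lborel_integral_reflect(2)) auto
    then show "AE x in lborel. integrable lborel (\<lambda>y. case (x, y) of (x, y) \<Rightarrow> gauss x * gauss y * Q (x - y))"
      by (simp add: hF)
  qed measurable
  have "integral\<^sup>L (lborel \<Otimes>\<^sub>M lborel) (\<lambda>(x, y). gauss x * gauss y * Q (x - y))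
     = (LINT x|lborel. LINT y|lborel. h x (x - y))"
    using lborel_pair.integral_fst'[OF I] by (simp add: hF)
  also have "\<dots> = (LINT x|lborel. LINT z|lborel. h x z)"
    by (intro Bochner_Integration.integral_cong refl lborel_integral_reflect) measurable
  also have "\<dots> = (LINT z|lborel. LINT x|lborel. h x z)"
    by (rule lborel_pair.Fubini_integral[OF hint, symmetric])
  also have "\<dots> = (LINT z|lborel. gauss (0::'a) / sqrt 2 ^ DIM('a) * (exp (- (norm z)\<^sup>2 / 4) * Q z))"
    unfolding h_def by (intro Bochner_Integration.integral_cong refl) (simp add: integral_gauss_gauss)
  finally show "integral\<^sup>L (lborel \<Otimes>\<^sub>M lborel) (\<lambda>(x, y). gauss x * gauss y * Q (x - y))
        = gauss (0::'a) / sqrt 2 ^ DIM('a) * (LINT z|lborel. exp (- (norm z)\<^sup>2 / 4) * Q z)"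
    by simp
qed

lemma prob_space_gauss: "prob_space (density lborel (gauss :: 'a::euclidean_space \<Rightarrow> real))"
proof (rule prob_spaceI)
  have "(\<integral>\<^sup>+x. ennreal (gauss (x::'a)) \<partial>lborel) = 1"
    by (subst nn_integral_eq_integral[OF integrable_gauss]) (auto simp: gauss_nonneg integral_gauss)
  then show "emeasure (density lborel gauss) (space (density lborel (gauss::'a \<Rightarrow> real))) = 1"
    by (simp add: emeasure_density)
qed

text \<open>Real coefficients can replace a complex exponential: the averaged inequalities for the
  weights cos(x \<bullet> \<xi>) and sin(x \<bullet> \<xi>), both bounded by 1 as the averaging
  demands, add up by the addition formula to the cosine of the difference.\<close>

lemma pos_def_fun_gauss:
  fixes q q' :: "'a::euclidean_space \<Rightarrow> real"
  assumes q: "pos_def_fun q" and ae: "AE z in lborel. q z = q' z" and q': "integrable lborel q'"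
  shows "0 \<le> (LINT z|lborel. exp (- (norm z)\<^sup>2 / 4) * (q' z * cos (z \<bullet> \<xi>)))"
proof -
  define M where "M = density lborel (gauss :: 'a \<Rightarrow> real)"
  have M: "prob_space M" "sets M = sets borel" unfolding M_def by (auto intro: prob_space_gauss)
  interpret M: prob_space M by fact
  have ac: "absolutely_continuous lborel M"
    unfolding M_def by (rule absolutely_continuousI_density) simp
  have [measurable]: "q' \<in> borel_measurable borel" using q' by auto
  have MM: "M \<Otimes>\<^sub>M M = density (lborel \<Otimes>\<^sub>M lborel) (\<lambda>p. ennreal (gauss (fst p) * gauss (snd p)))"
    unfolding M_def
    by (subst pair_measure_density)
      (auto simp: ennreal_mult gauss_nonneg split_beta' intro: lborel.sigma_finite_measure_axioms
        prob_space_imp_sigma_finite prob_space_gauss)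
  have *: "integrable (M \<Otimes>\<^sub>M M) (\<lambda>(x, y). c x * c y * q' (x - y)) \<and>
     0 \<le> integral\<^sup>L (lborel \<Otimes>\<^sub>M lborel) (\<lambda>(x, y). gauss x * gauss y * (c x * c y * q' (x - y))) \<and>
     integrable (lborel \<Otimes>\<^sub>M lborel) (\<lambda>(x, y). gauss x * gauss y * (c x * c y * q' (x - y)))"
    if c: "\<And>x. \<bar>c x\<bar> \<le> 1" and [measurable]: "c \<in> borel_measurable borel" for c :: "'a \<Rightarrow> real"
  proof -
    have I: "integrable (lborel \<Otimes>\<^sub>M lborel) (\<lambda>(x, y). gauss x * gauss y * (c x * c y * q' (x - y)))"
    proof (rule Bochner_Integration.integrable_bound[OF integrable_gauss_average[OF q']])
      have cc: "\<bar>c x * c y\<bar> \<le> 1" for x y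
        using mult_mono[OF c c, of y x] by (simp add: abs_mult)
      have "norm (gauss x * gauss y * (c x * c y * q' (x - y))) \<le> norm (gauss x * gauss y * q' (x - y))" for x y
        using mult_right_mono[OF cc[of x y], of "norm (gauss x * gauss y * q' (x - y))"]
        by (simp add: abs_mult mult_ac)
      then show "AE p in lborel \<Otimes>\<^sub>M lborel. norm (case p of (x, y) \<Rightarrow> gauss x * gauss y * (c x * c y * q' (x - y)))
            \<le> norm (case p of (x, y) \<Rightarrow> gauss x * gauss y * q' (x - y))"
        by auto
    qed measurable
    then have J: "integrable (M \<Otimes>\<^sub>M M) (\<lambda>(x, y). c x * c y * q' (x - y))"
      unfolding MM by (subst integrable_density) (auto simp: gauss_nonneg split_beta')
    have "0 \<le> integral\<^sup>L (M \<Otimes>\<^sub>M M) (\<lambda>(x, y). c x * c y * q' (x - y))"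
      by (rule pos_def_fun_average[OF q ae M(1) ac M(2) c J])
    also have "\<dots> = integral\<^sup>L (lborel \<Otimes>\<^sub>M lborel) (\<lambda>(x, y). gauss x * gauss y * (c x * c y * q' (x - y)))"
      unfolding MM by (subst integral_density) (auto simp: gauss_nonneg split_beta')
    finally show ?thesis using I J by simp
  qed
  let ?Q = "\<lambda>z. q' z * cos (z \<bullet> \<xi>)"
  have c: "\<And>x. \<bar>cos (x \<bullet> \<xi>)\<bar> \<le> 1" and s: "\<And>x. \<bar>sin (x \<bullet> \<xi>)\<bar> \<le> 1" by auto
  have mc: "(\<lambda>x. cos (x \<bullet> \<xi>)) \<in> borel_measurable borel" and ms: "(\<lambda>x. sin (x \<bullet> \<xi>)) \<in> borel_measurable borel"
    by measurable
  have QI: "integrable lborel ?Q"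
    by (rule Bochner_Integration.integrable_bound[OF q']) (auto simp: abs_mult intro!: mult_left_le)
  have "0 \<le> integral\<^sup>L (lborel \<Otimes>\<^sub>M lborel) (\<lambda>(x, y). gauss x * gauss y * (cos (x \<bullet> \<xi>) * cos (y \<bullet> \<xi>) * q' (x - y)))
     + integral\<^sup>L (lborel \<Otimes>\<^sub>M lborel) (\<lambda>(x, y). gauss x * gauss y * (sin (x \<bullet> \<xi>) * sin (y \<bullet> \<xi>) * q' (x - y)))"
    using *[OF c mc] *[OF s ms] by simp
  also have "\<dots> = integral\<^sup>L (lborel \<Otimes>\<^sub>M lborel) (\<lambda>(x, y). gauss x * gauss y * ?Q (x - y))"
    using *[OF c mc] *[OF s ms]
    by (subst Bochner_Integration.integral_add[symmetric])
      (auto simp: split_beta' inner_diff_left cos_diff algebra_simps)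
  also have "\<dots> = gauss (0::'a) / sqrt 2 ^ DIM('a) * (LINT z|lborel. exp (- (norm z)\<^sup>2 / 4) * ?Q z)"
    by (rule integral_gauss_average[OF QI])
  finally show ?thesis
    using divide_pos_pos[OF gauss_pos[of "0::'a"], of "sqrt 2 ^ DIM('a)"]
    by (meson linorder_not_less mult_pos_neg zero_less_power real_sqrt_gt_zero zero_less_numeral)
qed

text \<open>Positive definiteness survives dilation, so the Gaussian-weighted inequality applies to
  the function x to q(t x) at the frequency t \<xi>. Undoing the dilation stretches the weight to
  exp(-|u/t|^2/4), which tends to 1 as t grows, and dominated convergence removes it.\<close>

theorem pos_def_fun_fourier_nonneg:
  fixes q :: "'a::euclidean_space \<Rightarrow> real"
  assumes q: "pos_def_fun q" and ae: "AE z in lborel. q z = q' z" and q': "integrable lborel q'"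
  shows "0 \<le> (LINT x|lborel. q' x * cos (x \<bullet> \<xi>))"
proof -
  have [measurable]: "q' \<in> borel_measurable borel" using q' by auto
  let ?e = "\<lambda>n u. exp (- (norm (u /\<^sub>R real (Suc n)))\<^sup>2 / 4) * (q' u * cos (u \<bullet> \<xi>))"
  have "0 \<le> (LINT u|lborel. ?e n u)" for n
  proof -
    let ?t = "real (Suc n)"
    have "pos_def_fun (\<lambda>x. q (?t *\<^sub>R x))"
      unfolding pos_def_fun_def
    proof (intro allI)
      fix N x and c :: "nat \<Rightarrow> real"
      have "(\<Sum>a<N. \<Sum>b<N. c a * c b * q (?t *\<^sub>R x a - ?t *\<^sub>R x b)) \<ge> 0"
        by (rule q[unfolded pos_def_fun_def, rule_format])
      then show "(\<Sum>a<N. \<Sum>b<N. c a * c b * q (?t *\<^sub>R (x a - x b))) \<ge> 0"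
        by (simp only: scaleR_diff_right)
    qed
    moreover have "AE z in lborel. q (?t *\<^sub>R z) = q' (?t *\<^sub>R z)"
    proof -
      have "AE z in density (distr lborel borel (\<lambda>x::'a. 0 + ?t *\<^sub>R x)) (\<lambda>_. \<bar>?t\<bar> ^ DIM('a)). q z = q' z"
        using ae by (subst (asm) lborel_affine[of ?t "0::'a"]) simp
      then have "AE z in distr lborel borel (\<lambda>x::'a. 0 + ?t *\<^sub>R x). q z = q' z"
        by (subst (asm) AE_density) auto
      from AE_distrD[OF _ this] show ?thesis by simp
    qed
    moreover have "integrable lborel (\<lambda>x. q' (?t *\<^sub>R x))"
      by (rule integrable_scaleR[OF _ _ q']) auto
    ultimately have "0 \<le> (LINT z|lborel. exp (- (norm z)\<^sup>2 / 4) * (q' (?t *\<^sub>R z) * cos (z \<bullet> (?t *\<^sub>R \<xi>))))"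
      by (rule pos_def_fun_gauss)
    also have "\<dots> = (LINT z|lborel. ?e n (?t *\<^sub>R z))"
      by (intro Bochner_Integration.integral_cong) auto
    also have "\<dots> = (LINT u|lborel. ?e n u) / ?t ^ DIM('a)"
      by (rule integral_scaleR) (simp, measurable)
    finally show ?thesis
      by (meson divide_neg_pos linorder_not_less zero_less_power of_nat_0_less_iff zero_less_Suc)
  qed
  moreover have "(\<lambda>n. LINT u|lborel. ?e n u) \<longlonglongrightarrow> (LINT u|lborel. q' u * cos (u \<bullet> \<xi>))"
  proof (rule integral_dominated_convergence)
    show "integrable lborel (\<lambda>u. \<bar>q' u\<bar>)" using q' by simp
    show "AE u in lborel. (\<lambda>n. ?e n u) \<longlonglongrightarrow> q' u * cos (u \<bullet> \<xi>)"
    proof (rule AE_I2)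
      fix u
      have "(\<lambda>n. inverse (real (Suc n))) \<longlonglongrightarrow> 0" by (rule LIMSEQ_inverse_real_of_nat)
      then have "(\<lambda>n. ?e n u) \<longlonglongrightarrow> exp (- (norm (0 *\<^sub>R u))\<^sup>2 / 4) * (q' u * cos (u \<bullet> \<xi>))"
        by (intro tendsto_intros) auto
      then show "(\<lambda>n. ?e n u) \<longlonglongrightarrow> q' u * cos (u \<bullet> \<xi>)" by simp
    qed
    fix n
    show "AE u in lborel. norm (?e n u) \<le> \<bar>q' u\<bar>"
    proof (rule AE_I2)
      fix u
      have "\<bar>exp (- (norm (u /\<^sub>R real (Suc n)))\<^sup>2 / 4)\<bar> * (\<bar>q' u\<bar> * \<bar>cos (u \<bullet> \<xi>)\<bar>) \<le> 1 * (\<bar>q' u\<bar> * 1)"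
        by (intro mult_mono) auto
      then show "norm (?e n u) \<le> \<bar>q' u\<bar>" by (simp add: abs_mult)
    qed
  qed measurable
  ultimately show ?thesis by (intro LIMSEQ_le_const) auto
qed

section \<open>Polar coordinates\<close>

text \<open>Surface measure as cone volume: a set of directions is weighed by d times the volume of
  the part of the unit ball above it. The factor d compensates the integral 1/d of r^(d-1) over the
  unit interval. The measure lives on the whole space; \<open>sgn\<close> sends only the origin, a
  null set, off the unit sphere.\<close>

definition sphere_measure :: "'a::euclidean_space measure"
  where "sphere_measure =
    distr (density lborel (\<lambda>x. of_nat DIM('a) * indicator {x. norm x \<le> 1} x)) borel sgn"

definition radial_measure :: "nat \<Rightarrow> real measure"
  where "radial_measure n = density lborel (\<lambda>r. ennreal (indicator {0<..} r * r ^ n))"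

lemma borel_measurable_sgn_euclidean[measurable]:
  "(sgn :: 'a::euclidean_space \<Rightarrow> 'a) \<in> borel_measurable borel"
  unfolding sgn_div_norm[abs_def] by measurable

lemma borel_measurable_norm_euclidean:
  "(norm :: 'a::euclidean_space \<Rightarrow> real) \<in> borel_measurable borel"
  by measurable

lemma sets_sphere_measure[simp, measurable_cong]: "sets sphere_measure = sets borel"
  and space_sphere_measure[simp]: "space sphere_measure = UNIV"
  by (simp_all add: sphere_measure_def)

lemma sets_radial_measure[simp, measurable_cong]: "sets (radial_measure n) = sets borel"
  and space_radial_measure[simp]: "space (radial_measure n) = UNIV"
  by (simp_all add: radial_measure_def)

lemma emeasure_sphere_measure:
  assumes [measurable]: "B \<in> sets borel"
  shows "emeasure sphere_measure B =
    of_nat DIM('a::euclidean_space) * emeasure lborel {x::'a. norm x \<le> 1 \<and> sgn x \<in> B}"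
proof -
  have *: "(\<lambda>x::'a. of_nat DIM('a) * indicator {x. norm x \<le> 1} x :: ennreal) \<in> borel_measurable borel"
    by measurable
  have "emeasure sphere_measure B =
      (\<integral>\<^sup>+x. of_nat DIM('a) * indicator {x. norm x \<le> 1} x * indicator (sgn -` B) x \<partial>(lborel :: 'a measure))"
    using measurable_sets[OF borel_measurable_sgn_euclidean assms] * unfolding sphere_measure_def
    by (simp add: emeasure_distr emeasure_density)
  also have "\<dots> = (\<integral>\<^sup>+x. of_nat DIM('a) * indicator {x. norm x \<le> 1 \<and> sgn x \<in> B} x \<partial>(lborel :: 'a measure))"
    by (intro nn_integral_cong) (auto split: split_indicator)
  also have "\<dots> = of_nat DIM('a) * emeasure lborel {x::'a. norm x \<le> 1 \<and> sgn x \<in> B}"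
    by (subst nn_integral_cmult_indicator) auto
  finally show ?thesis .
qed

lemma finite_sphere_measure: "finite_measure (sphere_measure :: 'a::euclidean_space measure)"
proof
  have "emeasure lborel {x::'a. norm x \<le> 1} = emeasure lborel (cball (0::'a) 1)"
    by (intro arg_cong[where f = "emeasure lborel"]) auto
  also have "\<dots> < \<infinity>"
    by (rule emeasure_bounded_finite) simp
  finally have "of_nat DIM('a) * emeasure lborel {x::'a. norm x \<le> 1} < \<infinity>"
    by (simp add: ennreal_mult_less_top ennreal_of_nat_eq_real_of_nat)
  then show "emeasure (sphere_measure :: 'a measure) (space sphere_measure) \<noteq> \<infinity>"
    by (simp add: emeasure_sphere_measure)
qed

lemma sphere_measure_nonzero: "emeasure (sphere_measure :: 'a::euclidean_space measure) UNIV \<noteq> 0"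
proof -
  have "emeasure lborel {x::'a. norm x \<le> 1} = emeasure lborel (cball (0::'a) 1)"
    by (intro arg_cong[where f = "emeasure lborel"]) auto
  also have "\<dots> \<noteq> 0"
    using unit_ball_vol_pos[of "real DIM('a)"] by (simp add: emeasure_cball ennreal_eq_0_iff not_le)
  finally show ?thesis
    by (auto simp: emeasure_sphere_measure)
qed

text \<open>Asking for \<open>P\<close> on the whole closed ball covers the value
  \<open>sgn 0 = 0\<close>, which is not on the sphere.\<close>

lemma AE_sphere_measure:
  assumes "\<And>x. norm x \<le> 1 \<Longrightarrow> P x" "Measurable.pred borel P"
  shows "AE x in sphere_measure. P (x :: 'a::euclidean_space)"
  unfolding sphere_measure_def using assms
  by (subst AE_distr_iff) (auto simp: norm_sgn)

lemma sigma_finite_radial_measure: "sigma_finite_measure (radial_measure n)"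
  unfolding radial_measure_def
  by (subst sigma_finite_measure.sigma_finite_iff_density_finite[OF lborel.sigma_finite_measure_axioms]) auto

lemma emeasure_radial_measure_atMost:
  assumes "n > 0"
  shows "emeasure (radial_measure (n - 1)) {..a} = ennreal (if a > 0 then a ^ n / n else 0)"
proof (cases "a > 0")
  case True
  have "emeasure (radial_measure (n - 1)) {..a} = (\<integral>\<^sup>+r. ennreal (indicator {0<..} r * r ^ (n - 1)) * indicator {..a} r \<partial>lborel)"
    unfolding radial_measure_def by (subst emeasure_density) auto
  also have "\<dots> = (\<integral>\<^sup>+r. ennreal (r ^ (n - 1)) * indicator {0..a} r \<partial>lborel)"
    by (rule nn_integral_cong_AE, use AE_lborel_singleton[of "0::real"] in eventually_elim)
      (auto split: split_indicator)
  also have "\<dots> = ennreal (a ^ n / n - 0 ^ n / n)"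
  proof (rule nn_integral_FTC_Icc)
    fix x :: real
    show "((\<lambda>x. x ^ n / n) has_real_derivative x ^ (n - 1)) (at x)"
      using assms by (auto intro!: derivative_eq_intros)
  qed (use True in auto)
  finally show ?thesis using True assms by (simp add: zero_power)
next
  case False
  have "emeasure (radial_measure (n - 1)) {..a} = (\<integral>\<^sup>+r. ennreal (indicator {0<..} r * r ^ (n - 1)) * indicator {..a} r \<partial>lborel)"
    unfolding radial_measure_def by (subst emeasure_density) auto
  also have "\<dots> = (\<integral>\<^sup>+r. 0 \<partial>(lborel :: real measure))"
    using False by (intro nn_integral_cong) (auto split: split_indicator)
  finally show ?thesis using False by simp
qed

lemma emeasure_cone_scale:
  assumes [measurable]: "B \<in> sets borel"
  shows "emeasure lborel {x::'a::euclidean_space. norm x \<le> a \<and> sgn x \<in> B}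
    = ennreal (if a > 0 then a ^ DIM('a) else 0) * emeasure lborel {x::'a. norm x \<le> 1 \<and> sgn x \<in> B}"
proof (cases "a > 0")
  case True
  have "emeasure lborel {x::'a. norm x \<le> a \<and> sgn x \<in> B}
      = ennreal (a ^ DIM('a)) * emeasure lborel ((\<lambda>x. a *\<^sub>R x) -` {x::'a. norm x \<le> a \<and> sgn x \<in> B})"
    using True by (subst lborel_affine[of a "0::'a"])
      (auto simp: emeasure_density nn_integral_cmult_indicator emeasure_distr space_pair_measure)
  also have "(\<lambda>x. a *\<^sub>R x) -` {x::'a. norm x \<le> a \<and> sgn x \<in> B} = {x. norm x \<le> 1 \<and> sgn x \<in> B}"
    using True by (auto simp: sgn_scaleR)
  finally show ?thesis using True by simp
next
  case False
  have "emeasure lborel {x::'a. norm x \<le> a \<and> sgn x \<in> B} \<le> emeasure lborel {0::'a}"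
    using False by (intro emeasure_mono) (auto simp flip: norm_le_zero_iff)
  then show ?thesis using False by simp
qed

text \<open>For a fixed set \<open>B\<close> of directions both sides are measures in the radius.
  The cone over \<open>B\<close> up to radius a has volume proportional to a^d, which is d times the
  integral of r^(d-1) up to a; so the two agree on half-lines, and finiteness on each
  \<open>{..real n}\<close> gives uniqueness.\<close>

theorem polar_coordinates:
  "radial_measure (DIM('a) - 1) \<Otimes>\<^sub>M (sphere_measure :: 'a::euclidean_space measure)
    = distr lborel (borel \<Otimes>\<^sub>M borel) (\<lambda>x. (norm x, sgn x))"
proof (rule pair_measure_eqI)
  show "sigma_finite_measure (radial_measure (DIM('a) - 1))" by (rule sigma_finite_radial_measure)
  show "sigma_finite_measure (sphere_measure :: 'a measure)"
    by (rule finite_measure.sigma_finite_measure[OF finite_sphere_measure, unfolded finite_measure_def])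
  show "sets (radial_measure (DIM('a) - 1) \<Otimes>\<^sub>M (sphere_measure :: 'a measure))
     = sets (distr lborel (borel \<Otimes>\<^sub>M borel) (\<lambda>x::'a. (norm x, sgn x)))"
    by (simp cong: sets_pair_measure_cong)
  fix A B assume "A \<in> sets (radial_measure (DIM('a) - 1))" and "B \<in> sets (sphere_measure :: 'a measure)"
  then have [measurable]: "A \<in> sets borel" "B \<in> sets borel" by simp_all
  define c where "c = emeasure (sphere_measure :: 'a measure) B"
  interpret S: finite_measure "sphere_measure :: 'a measure" by (rule finite_sphere_measure)
  have c: "c < \<infinity>" unfolding c_def using S.emeasure_finite[of B] by (simp only: less_top infinity_ennreal_def)
  have cone: "of_nat DIM('a) * emeasure lborel {x::'a. norm x \<le> 1 \<and> sgn x \<in> B} = c"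
    unfolding c_def by (simp add: emeasure_sphere_measure)
  let ?N1 = "scale_measure c (radial_measure (DIM('a) - 1))"
  let ?N2 = "distr (density lborel (indicator {x::'a. sgn x \<in> B})) borel norm"
  have N1: "emeasure ?N1 {..a} = c * ennreal (if a > 0 then a ^ DIM('a) / DIM('a) else 0)" for a
    by (simp only: emeasure_scale_measure emeasure_radial_measure_atMost[OF DIM_positive])
  have mB: "{x::'a. sgn x \<in> B} \<in> sets borel" by measurable
  have N2': "emeasure ?N2 X = emeasure lborel {x::'a. norm x \<in> X \<and> sgn x \<in> B}" if [measurable]: "X \<in> sets borel" for X
  proof -
    have "emeasure ?N2 X = (\<integral>\<^sup>+x. indicator {x. sgn x \<in> B} x * indicator (norm -` X) x \<partial>(lborel :: 'a measure))"
      using measurable_sets[OF borel_measurable_norm_euclidean[where 'a='a] that] mB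
      by (subst emeasure_distr) (simp_all add: emeasure_density)
    also have "\<dots> = (\<integral>\<^sup>+x. indicator {x. norm x \<in> X \<and> sgn x \<in> B} x \<partial>(lborel :: 'a measure))"
      by (intro nn_integral_cong) (auto split: split_indicator)
    finally show ?thesis by simp
  qed
  have N2: "emeasure ?N2 {..a} = emeasure lborel {x::'a. norm x \<le> a \<and> sgn x \<in> B}" for a
    by (simp add: N2')
  have eq: "emeasure ?N1 {..a} = emeasure ?N2 {..a}" for a
  proof -
    have *: "ennreal (if a > 0 then a ^ DIM('a) else 0) = of_nat DIM('a) * ennreal (if a > 0 then a ^ DIM('a) / DIM('a) else 0)"
      by (simp add: ennreal_of_nat_eq_real_of_nat ennreal_mult[symmetric] split: if_splits)
    have "emeasure ?N2 {..a} = c * ennreal (if a > 0 then a ^ DIM('a) / DIM('a) else 0)"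
      unfolding N2 emeasure_cone_scale[OF \<open>B \<in> sets borel\<close>, of a] cone[symmetric] *
      by (simp only: mult_ac)
    then show ?thesis by (simp only: N1)
  qed
  have "?N1 = ?N2"
  proof (rule measure_eqI_generator_eq[where E = "range (\<lambda>a::real. {..a})" and \<Omega> = UNIV and A = "\<lambda>n. {..real n}"])
    show "Int_stable (range (\<lambda>a::real. {..a}))"
      by (auto simp: Int_stable_def)
    show "sets ?N1 = sigma_sets UNIV (range (\<lambda>a::real. {..a}))"
         "sets ?N2 = sigma_sets UNIV (range (\<lambda>a::real. {..a}))"
      by (simp_all add: borel_eq_atMost)
    show "(\<Union>n. {..real n}) = UNIV" by (auto intro: real_arch_simple)
    show "emeasure ?N1 {..real n} \<noteq> \<infinity>" for n
      unfolding N1 using c by (auto simp: ennreal_mult_eq_top_iff)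
    show "emeasure ?N1 X = emeasure ?N2 X" if "X \<in> range (\<lambda>a. {..a})" for X
      using that eq by auto
  qed auto
  then have "emeasure ?N1 A = emeasure ?N2 A" by simp
  then have "emeasure (radial_measure (DIM('a) - 1)) A * emeasure sphere_measure B
      = emeasure lborel {x::'a. norm x \<in> A \<and> sgn x \<in> B}"
    by (simp add: N2' c_def mult.commute)
  also have "\<dots> = emeasure (distr lborel (borel \<Otimes>\<^sub>M borel) (\<lambda>x::'a. (norm x, sgn x))) (A \<times> B)"
    by (subst emeasure_distr) (auto intro!: arg_cong[where f = "emeasure lborel"])
  finally show "emeasure (radial_measure (DIM('a) - 1)) A * emeasure sphere_measure B
     = emeasure (distr lborel (borel \<Otimes>\<^sub>M borel) (\<lambda>x::'a. (norm x, sgn x))) (A \<times> B)" .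
qed

section \<open>Moments of the sphere measure\<close>

lemma polar_integral:
  fixes F :: "real \<Rightarrow> 'a::euclidean_space \<Rightarrow> real"
  assumes F[measurable]: "(\<lambda>(r, \<omega>). F r \<omega>) \<in> borel_measurable (borel \<Otimes>\<^sub>M borel)"
    and int: "integrable lborel (\<lambda>x. F (norm x) (sgn x))"
  shows "(LINT x|lborel. F (norm x) (sgn x))
    = (LINT r|lborel. indicator {0<..} r * r ^ (DIM('a) - 1) * (LINT \<omega>|sphere_measure. F r \<omega>))"
proof -
  let ?R = "radial_measure (DIM('a) - 1)" and ?S = "sphere_measure :: 'a measure"
  interpret S: finite_measure ?S by (rule finite_sphere_measure)
  interpret R: sigma_finite_measure ?R by (rule sigma_finite_radial_measure)
  interpret RS: pair_sigma_finite ?R ?S ..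
  have m: "(\<lambda>x::'a. (norm x, sgn x)) \<in> lborel \<rightarrow>\<^sub>M borel \<Otimes>\<^sub>M borel" by measurable
  have int': "integrable (?R \<Otimes>\<^sub>M ?S) (\<lambda>(r, \<omega>). F r \<omega>)"
    unfolding polar_coordinates using int by (subst integrable_distr_eq[OF m F]) auto
  have "(LINT x|lborel. F (norm x) (sgn x)) = integral\<^sup>L (?R \<Otimes>\<^sub>M ?S) (\<lambda>(r, \<omega>). F r \<omega>)"
    unfolding polar_coordinates by (subst integral_distr[OF m F]) auto
  also have "\<dots> = (LINT r|?R. LINT \<omega>|?S. F r \<omega>)"
    using RS.integral_fst'[OF int'] by simp
  also have "\<dots> = (LINT r|lborel. (indicator {0<..} r * r ^ (DIM('a) - 1)) *\<^sub>R (LINT \<omega>|?S. F r \<omega>))"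
    unfolding radial_measure_def
    by (rule integral_density) (auto simp: indicator_def intro!: S.borel_measurable_lebesgue_integral)
  finally show ?thesis by simp
qed

section \<open>Null sets of radii and Borel representatives of radial functions\<close>

lemma AE_radial_measure: "(AE r in radial_measure n. P r) \<longleftrightarrow> (AE r in lborel. r > 0 \<longrightarrow> P r)"
  unfolding radial_measure_def
  by (subst AE_density) (auto simp: indicator_def ennreal_eq_0_iff not_le intro!: AE_cong)

text \<open>In polar coordinates the exceptional vectors lie in a null set of radii times all
  directions, which is null for the product measure.\<close>

lemma AE_norm:
  assumes "AE r in lborel. r > 0 \<longrightarrow> P r"
  shows "AE x in lborel. P (norm (x :: 'a::euclidean_space))"
proof -
  let ?R = "radial_measure (DIM('a) - 1)" and ?S = "sphere_measure :: 'a measure"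
  interpret S: finite_measure ?S by (rule finite_sphere_measure)
  interpret R: sigma_finite_measure ?R by (rule sigma_finite_radial_measure)
  interpret RS: pair_sigma_finite ?R ?S ..
  from assms have "AE r in ?R. P r" by (simp add: AE_radial_measure)
  from AE_E[OF this] obtain N where N: "{r \<in> space ?R. \<not> P r} \<subseteq> N" "emeasure ?R N = 0" "N \<in> sets ?R"
    by blast
  then have [measurable]: "N \<in> sets borel" by simp
  have "AE r in ?R. AE \<omega> in ?S. r \<notin> N"
    using AE_not_in[of N ?R] N by (auto simp: null_sets_def)
  moreover have "Measurable.pred (borel \<Otimes>\<^sub>M borel) (\<lambda>z::real \<times> 'a. fst z \<notin> N)"
    by measurable
  then have "{z::real \<times> 'a. fst z \<notin> N} \<in> sets (borel \<Otimes>\<^sub>M borel)"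
    by (simp add: pred_def space_pair_measure)
  ultimately have "AE z in ?R \<Otimes>\<^sub>M ?S. fst z \<notin> N"
    by (intro RS.AE_pair_measure) (simp_all add: space_pair_measure cong: sets_pair_measure_cong)
  then have "AE x in lborel. norm (x::'a) \<notin> N"
    unfolding polar_coordinates by (subst (asm) AE_distr_iff) auto
  then show ?thesis using N(1) by (auto elim!: eventually_mono)
qed

text \<open>By Fubini in polar coordinates, some ray meets the exceptional null set of a Borel
  representative on the whole space in a null set.\<close>

lemma radial_borel_representative:
  fixes f :: "real \<Rightarrow> real"
  assumes "(\<lambda>x::'a::euclidean_space. f (norm x)) \<in> borel_measurable lebesgue"
  obtains p where "p \<in> borel_measurable borel" "AE r in lborel. r > 0 \<longrightarrow> f r = p r"
proof -
  let ?R = "radial_measure (DIM('a) - 1)" and ?S = "sphere_measure :: 'a measure"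
  interpret S: finite_measure ?S by (rule finite_sphere_measure)
  interpret R: sigma_finite_measure ?R by (rule sigma_finite_radial_measure)
  interpret RS: pair_sigma_finite ?R ?S ..
  from completion_ex_borel_measurable_real[OF assms]
  obtain g :: "'a \<Rightarrow> real" where g[measurable]: "g \<in> borel_measurable borel"
    and ae: "AE x in lborel. f (norm x) = g x"
    by auto
  from AE_E[OF ae] obtain N where
    N: "{x \<in> space lborel. f (norm x) \<noteq> g x} \<subseteq> N" "emeasure lborel N = 0" "N \<in> sets (lborel :: 'a measure)"
    by blast
  then have [measurable]: "N \<in> sets borel" by simp
  have polar: "norm x *\<^sub>R sgn x = x" for x :: 'a
    by (cases "x = 0") (auto simp: sgn_div_norm)
  have "AE x in lborel. norm x *\<^sub>R sgn x \<notin> N"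
    using AE_not_in[of N lborel] N by (simp add: null_sets_def polar)
  then have "AE z in ?R \<Otimes>\<^sub>M ?S. fst z *\<^sub>R snd z \<notin> N"
    unfolding polar_coordinates by (subst AE_distr_iff) auto
  then have "AE r in ?R. AE \<omega> in ?S. r *\<^sub>R \<omega> \<notin> N"
    using RS.AE_pair[of "\<lambda>z. fst z *\<^sub>R snd z \<notin> N"] by simp
  then have "AE \<omega> in ?S. AE r in ?R. r *\<^sub>R \<omega> \<notin> N"
  proof (subst (asm) RS.AE_commute)
    have "Measurable.pred (borel \<Otimes>\<^sub>M borel) (\<lambda>z::real \<times> 'a. fst z *\<^sub>R snd z \<notin> N)"
      by measurable
    then show "{z \<in> space (?R \<Otimes>\<^sub>M ?S). fst z *\<^sub>R snd z \<notin> N} \<in> sets (?R \<Otimes>\<^sub>M ?S)"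
      by (simp add: pred_def space_pair_measure cong: sets_pair_measure_cong)
  qed
  moreover have "AE \<omega> in ?S. norm \<omega> = 1"
    unfolding sphere_measure_def
    by (subst AE_distr_iff) (use AE_lborel_singleton[of "0::'a"] in
        \<open>auto simp: AE_density norm_sgn elim!: eventually_mono\<close>)
  ultimately have H: "AE \<omega> in ?S. norm \<omega> = 1 \<and> (AE r in ?R. r *\<^sub>R \<omega> \<notin> N)"
    by auto
  have "\<exists>\<omega>. norm \<omega> = 1 \<and> (AE r in ?R. r *\<^sub>R \<omega> \<notin> N)"
  proof (rule ccontr)
    \<comment> \<open>Almost all directions are good. If there were none at all,
      \<open>False\<close> would hold almost everywhere and the nonzero measure of the sphere would
      vanish.\<close>
    assume no: "\<nexists>\<omega>. norm \<omega> = 1 \<and> (AE r in ?R. r *\<^sub>R \<omega> \<notin> N)"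
    have "AE \<omega> in ?S. False"
      using H by (rule eventually_mono) (use no in blast)
    then show False
      using sphere_measure_nonzero[where 'a='a]
      by (simp add: trivial_limit_def[symmetric] ae_filter_eq_bot_iff)
  qed
  then obtain \<omega> where \<omega>: "norm \<omega> = 1" "AE r in ?R. r *\<^sub>R \<omega> \<notin> N" by blast
  have "AE r in lborel. r > 0 \<longrightarrow> f r = g (r *\<^sub>R \<omega>)"
    using \<omega>(2) unfolding AE_radial_measure
  proof (rule eventually_mono, intro impI)
    fix r :: real assume "r > 0 \<longrightarrow> r *\<^sub>R \<omega> \<notin> N" "r > 0"
    then have "f (norm (r *\<^sub>R \<omega>)) = g (r *\<^sub>R \<omega>)" using N(1) by (auto simp del: norm_scaleR)
    then show "f r = g (r *\<^sub>R \<omega>)" using \<omega>(1) \<open>r > 0\<close> by simp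
  qed
  moreover have "(\<lambda>r. g (r *\<^sub>R \<omega>)) \<in> borel_measurable borel" by measurable
  ultimately show ?thesis using that by blast
qed

section \<open>Gamma values at half-integers and Gaussian moments\<close>

lemma Gamma_nat_half: "Gamma (real k + 1/2) = fact (2 * k) / (2 ^ (2 * k) * fact k) * sqrt pi"
proof (induction k)
  case 0
  show ?case by (simp add: Gamma_one_half_real)
next
  case (Suc k)
  have "Gamma (real (Suc k) + 1/2) = Gamma ((real k + 1/2) + 1)" by (simp add: add_ac)
  also have "\<dots> = (real k + 1/2) * Gamma (real k + 1/2)"
    by (rule Gamma_plus1) (auto elim!: nonpos_Ints_cases)
  also have "\<dots> = (real k + 1/2) * (fact (2 * k) / (2 ^ (2 * k) * fact k) * sqrt pi)"
    by (simp only: Suc)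
  also have "\<dots> = fact (2 * Suc k) / (2 ^ (2 * Suc k) * fact (Suc k)) * sqrt pi"
  proof -
    have 1: "fact (2 * Suc k) = 2 * (real k + 1) * (2 * real k + 1) * fact (2 * k)"
      by (simp add: algebra_simps)
    have 2: "fact (Suc k) = (real k + 1) * fact k" "(2::real) ^ (2 * Suc k) = 4 * 2 ^ (2 * k)"
      by simp_all
    have "real k + 1 \<noteq> 0" by simp
    then show ?thesis unfolding 1 2 by (simp add: divide_simps) (simp add: algebra_simps)
  qed
  finally show ?case .
qed

text \<open>One formula for both parities, as the substitution s = x^2 would suggest. Both are
  wanted, because the radial exponent in the next computation is d - 1 plus an even number.\<close>

lemma gaussian_half_moment:
  "has_bochner_integral lborel (\<lambda>x::real. indicator {0..} x *\<^sub>R (exp (- x\<^sup>2) * x ^ n)) (Gamma ((real n + 1) / 2) / 2)"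
proof (cases "even n")
  case True
  then obtain k where k: "n = 2 * k" by (elim evenE)
  have "(real n + 1) / 2 = real k + 1/2" unfolding k by simp
  then have eq: "Gamma ((real n + 1) / 2) / 2 = sqrt pi / 2 * (fact (2 * k) / (2 ^ (2 * k) * fact k))"
    unfolding \<open>(real n + 1) / 2 = real k + 1/2\<close> Gamma_nat_half by (simp add: mult_ac)
  show ?thesis using gaussian_moment_even_pos[of k] unfolding eq unfolding k .
next
  case False
  then obtain k where k: "n = 2 * k + 1" by (elim oddE)
  have "(real n + 1) / 2 = 1 + real k" unfolding k by simp
  then have "Gamma ((real n + 1) / 2) / 2 = fact k / 2"
    unfolding \<open>(real n + 1) / 2 = 1 + real k\<close> Gamma_fact by simp
  then show ?thesis using gaussian_moment_odd_pos[of k] unfolding k by simp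
qed

lemma gaussian_even_moment:
  "has_bochner_integral lborel (\<lambda>x::real. exp (- x\<^sup>2) * x ^ (2 * k)) (Gamma (real k + 1/2))"
proof -
  have "has_bochner_integral lborel (\<lambda>x::real. exp (- x\<^sup>2) * x ^ (2 * k)) (2 *\<^sub>R (Gamma ((real (2 * k) + 1) / 2) / 2))"
    by (rule has_bochner_integral_even_function[OF gaussian_half_moment]) simp
  then show ?thesis by (simp add: add_divide_distrib)
qed

lemma integrable_gaussian_power: "integrable lborel (\<lambda>x::real. exp (- x\<^sup>2) * x ^ (2 * k))"
  and integral_gaussian_power: "(LINT x|lborel. exp (- x\<^sup>2) * x ^ (2 * k)) = Gamma (real k + 1/2)"
  using gaussian_even_moment[of k] by (auto simp: has_bochner_integral_iff)

text \<open>The monomial is integrated against exp(-|x|^2): in coordinates this is the product of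
  the values Gamma(p b + 1/2), in polar coordinates the sought moment times half of Gamma(P + d/2),
  where P is the sum of the exponents. The weight is exp(-|x|^2) and not \<open>gauss\<close>, so
  that all one-dimensional integrals are pure Gamma values.\<close>

lemma sphere_even_moment:
  fixes p :: "'a::euclidean_space \<Rightarrow> nat"
  shows "(LINT \<omega>|sphere_measure. (\<Prod>b\<in>Basis. (\<omega> \<bullet> b) ^ (2 * p b)))
    = 2 * (\<Prod>b\<in>Basis. Gamma (real (p b) + 1/2)) / Gamma (real (sum p (Basis :: 'a set)) + real DIM('a) / 2)"
proof -
  let ?P = "sum p (Basis :: 'a set)" and ?d = "DIM('a)"
  let ?M = "LINT \<omega>|sphere_measure. (\<Prod>b\<in>Basis. (\<omega> \<bullet> b) ^ (2 * p b))"
  define e where "e = ?d - 1"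
  define F where "F r \<omega> = exp (- r\<^sup>2) * r ^ (2 * ?P) * (\<Prod>b\<in>Basis. (\<omega> \<bullet> b) ^ (2 * p b))" for r :: real and \<omega> :: 'a
  have F: "F (norm x) (sgn x) = (\<Prod>b\<in>Basis. exp (- (x \<bullet> b)\<^sup>2) * (x \<bullet> b) ^ (2 * p b))" for x
  proof -
    have "(norm x)\<^sup>2 = (\<Sum>b\<in>Basis. (x \<bullet> b)\<^sup>2)"
      unfolding power2_norm_eq_inner by (subst euclidean_inner) (simp add: power2_eq_square)
    moreover have "norm x ^ (2 * ?P) * (\<Prod>b\<in>Basis. (sgn x \<bullet> b) ^ (2 * p b)) = (\<Prod>b\<in>Basis. (x \<bullet> b) ^ (2 * p b))"
    proof (cases "x = 0")
      case False
      have "norm x ^ (2 * ?P) = (\<Prod>b\<in>Basis. norm x ^ (2 * p b :: nat))"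
        by (simp add: sum_distrib_left power_sum)
      then show ?thesis
        using False by (simp add: prod.distrib[symmetric] sgn_div_norm power_mult_distrib[symmetric] mult.assoc[symmetric])
    next
      \<comment> \<open>At the origin \<open>sgn 0 = 0\<close>: both sides vanish unless all
        exponents are zero, in which case both are 1.\<close>
      case True
      then show ?thesis by (cases "?P = 0") (auto simp: prod_zero_iff power_0_left intro!: bexI)
    qed
    ultimately show ?thesis
      unfolding F_def by (simp add: prod.distrib exp_sum[symmetric] sum_negf mult.assoc)
  qed
  have [measurable]: "(\<lambda>(r, \<omega>). F r \<omega>) \<in> borel_measurable (borel \<Otimes>\<^sub>M borel)"
    unfolding F_def by measurable
  have int: "integrable lborel (\<lambda>x. F (norm x) (sgn x))"
    unfolding F by (rule integrable_lborel_prod_Basis) (rule integrable_gaussian_power)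
  have "(\<Prod>b\<in>(Basis::'a set). Gamma (real (p b) + 1/2)) = (LINT x|lborel. F (norm x) (sgn x))"
    unfolding F by (subst integral_lborel_prod_Basis) (auto simp: integrable_gaussian_power integral_gaussian_power)
  also have "\<dots> = (LINT r|lborel. indicator {0<..} r * r ^ (e) * (LINT \<omega>|sphere_measure. F r \<omega>))"
    unfolding e_def by (rule polar_integral) (auto intro: int)
  also have "\<dots> = (LINT r|lborel. (indicator {0..} r *\<^sub>R (exp (- r\<^sup>2) * r ^ (e + 2 * ?P))) * ?M)"
  proof (rule integral_cong_AE)
    show "AE r in lborel. indicator {0<..} r * r ^ (e) * (LINT \<omega>|sphere_measure. F r \<omega>)
       = (indicator {0..} r *\<^sub>R (exp (- r\<^sup>2) * r ^ (e + 2 * ?P))) * ?M"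
      using AE_lborel_singleton[of "0::real"]
      by eventually_elim (auto simp: F_def power_add split: split_indicator)
    interpret S: finite_measure "sphere_measure :: 'a measure" by (rule finite_sphere_measure)
    show "(\<lambda>r. indicator {0<..} r * r ^ (e) * (LINT \<omega>|sphere_measure. F r \<omega>)) \<in> borel_measurable lborel"
      unfolding F_def by simp
  qed measurable
  also have "\<dots> = Gamma ((real (e + 2 * ?P) + 1) / 2) / 2 * ?M"
    using gaussian_half_moment[of "e + 2 * ?P"] by (auto simp: has_bochner_integral_iff)
  also have "(real (e + 2 * ?P) + 1) / 2 = real ?P + real ?d / 2"
  proof -
    have "real e = real ?d - 1" using DIM_positive[where 'a='a] by (simp add: e_def of_nat_diff Suc_leI)
    then show ?thesis unfolding of_nat_add of_nat_mult by (simp add: add_divide_distrib)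
  qed
  finally have "(\<Prod>b\<in>(Basis::'a set). Gamma (real (p b) + 1/2)) = Gamma (real ?P + real ?d / 2) / 2 * ?M" .
  moreover have "Gamma (real ?P + real ?d / 2) > 0"
    using DIM_positive[where 'a='a] by (intro Gamma_real_pos add_nonneg_pos of_nat_0_le_iff) simp
  ultimately show ?thesis by (simp add: field_simps)
qed

section \<open>Spherical integrals and Bessel functions\<close>

text \<open>The d - 2 remaining basis vectors get exponent 0 and contribute Gamma(1/2) = sqrt pi
  each.\<close>

lemma sphere_two_moment:
  fixes e c :: "'a::euclidean_space"
  assumes "e \<in> Basis" "c \<in> Basis" "e \<noteq> c"
  shows "(LINT \<omega>|sphere_measure. (\<omega> \<bullet> e) ^ (2 * m) * (\<omega> \<bullet> c) ^ (2 * j))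
    = 2 * Gamma (real m + 1/2) * Gamma (real j + 1/2) * sqrt pi ^ (DIM('a) - 2) / Gamma (real m + real j + real DIM('a) / 2)"
proof -
  define p where "p = (\<lambda>b::'a. if b = e then m else if b = c then j else 0)"
  have split: "(Basis :: 'a set) = insert e (insert c (Basis - {e, c}))" using assms by auto
  have fin: "finite (Basis - {e, c})" by simp
  have ce: "c \<noteq> e" using assms(3) by simp
  have rest: "b \<noteq> e" "b \<noteq> c" if "b \<in> Basis - {e, c}" for b using that by auto
  have prod: "prod h Basis = h e * (h c * prod h (Basis - {e, c}))" for h :: "'a \<Rightarrow> real"
    using assms by (subst split, subst prod.insert, simp, simp, subst prod.insert) auto
  have 1: "(\<Prod>b\<in>Basis. (\<omega> \<bullet> b) ^ (2 * p b)) = (\<omega> \<bullet> e) ^ (2 * m) * (\<omega> \<bullet> c) ^ (2 * j)" for \<omega>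
    unfolding prod using ce by (simp add: p_def)
  have 2: "(\<Prod>b\<in>Basis. Gamma (real (p b) + 1/2)) = Gamma (real m + 1/2) * Gamma (real j + 1/2) * sqrt pi ^ (DIM('a) - 2)"
  proof -
    have "(\<Prod>b\<in>Basis - {e, c}. Gamma (real (p b) + 1/2)) = (\<Prod>b\<in>Basis - {e, c}. sqrt pi)"
      by (intro prod.cong refl) (auto simp: p_def Gamma_one_half_real)
    also have "\<dots> = sqrt pi ^ (DIM('a) - 2)"
      using assms by (simp add: card_Diff_subset numeral_2_eq_2)
    finally show ?thesis unfolding prod using ce by (simp add: p_def)
  qed
  have 3: "sum p Basis = m + j"
    using assms by (subst split, subst sum.insert, simp, simp, subst sum.insert) (auto simp: p_def)
  show ?thesis using sphere_even_moment[of p] unfolding 1 2 3 by (simp add: mult.assoc)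
qed

lemma summable_even_exp: "summable (\<lambda>m. \<bar>t\<bar> ^ (2 * m) / fact (2 * m) :: real)"
proof (rule summable_comparison_test'[where N = 0])
  show "summable (\<lambda>m. inverse (fact m) * (t\<^sup>2) ^ m)" by (rule summable_exp)
  fix m :: nat
  have "(fact m :: real) \<le> fact (2 * m)" by (rule fact_mono) simp
  then have "\<bar>t\<bar> ^ (2 * m) / fact (2 * m) \<le> \<bar>t\<bar> ^ (2 * m) / fact m"
    by (intro divide_left_mono) auto
  also have "\<dots> = inverse (fact m) * (t\<^sup>2) ^ m"
    unfolding power_mult power2_abs by (simp only: divide_inverse mult.commute)
  finally have "\<bar>t\<bar> ^ (2 * m) / fact (2 * m) \<le> inverse (fact m) * (t\<^sup>2) ^ m" .
  moreover have "0 \<le> \<bar>t\<bar> ^ (2 * m) / fact (2 * m)" by simp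
  ultimately show "norm (\<bar>t\<bar> ^ (2 * m) / fact (2 * m)) \<le> inverse (fact m) * (t\<^sup>2) ^ m"
    unfolding real_norm_def by (simp only: abs_of_nonneg)
qed

text \<open>The cosine series is integrated termwise, dominated by |t|^(2m)/(2m)!. Since Gamma(m +
  1/2) = (2m)! sqrt pi/(4^m m!), the (2m)! of the cosine cancels and (t/2)^(2m)/m! is left. The
  denominator Gamma(m + j + d/2) is Gamma(m + \<nu> + 1), which dictates the order \<nu>; dividing
  by \<open>(t / 2) powr \<nu>\<close> strips the prefactor of \<open>bessel_J\<close>.\<close>

lemma sphere_cos:
  fixes e c :: "'a::euclidean_space"
  assumes ec: "e \<in> Basis" "c \<in> Basis" "e \<noteq> c" and t: "t > 0"
    and \<nu>: "\<nu> = real j + real DIM('a) / 2 - 1"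
  shows "(LINT \<omega>|sphere_measure. (\<omega> \<bullet> c) ^ (2 * j) * cos (t * (\<omega> \<bullet> e)))
    = 2 * Gamma (real j + 1/2) * sqrt pi ^ (DIM('a) - 1) * (bessel_J \<nu> t / (t / 2) powr \<nu>)" (is "?I = ?C * _")
proof -
  interpret S: finite_measure "sphere_measure :: 'a measure" by (rule finite_sphere_measure)
  define f where "f m \<omega> = (\<omega> \<bullet> c) ^ (2 * j) * ((-1) ^ m / fact (2 * m) * (t * (\<omega> \<bullet> e)) ^ (2 * m))" for m and \<omega> :: 'a
  have fb: "\<bar>f m \<omega>\<bar> \<le> \<bar>t\<bar> ^ (2 * m) / fact (2 * m)" if "norm \<omega> \<le> 1" for m \<omega>
  proof -
    have 1: "\<bar>\<omega> \<bullet> c\<bar> \<le> 1" "\<bar>\<omega> \<bullet> e\<bar> \<le> 1"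
      using that ec Basis_le_norm[of c \<omega>] Basis_le_norm[of e \<omega>] by auto
    have "\<bar>f m \<omega>\<bar> = \<bar>\<omega> \<bullet> c\<bar> ^ (2 * j) * (\<bar>\<omega> \<bullet> e\<bar> ^ (2 * m) * (\<bar>t\<bar> ^ (2 * m) / fact (2 * m)))"
      unfolding f_def by (simp add: abs_mult power_abs power_mult_distrib)
    also have "\<dots> \<le> 1 * (1 * (\<bar>t\<bar> ^ (2 * m) / fact (2 * m)))"
      using 1 by (intro mult_mono) (auto intro!: power_le_one)
    finally show ?thesis by simp
  qed
  have [measurable]: "f m \<in> borel_measurable borel" for m unfolding f_def[abs_def] by measurable
  have AEb: "AE \<omega> in sphere_measure. norm (f m \<omega>) \<le> \<bar>t\<bar> ^ (2 * m) / fact (2 * m)" for m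
    by (rule AE_sphere_measure) (use fb in auto)
  have int: "integrable sphere_measure (f m)" for m
    by (rule S.integrable_const_bound[OF AEb]) simp
  have sm: "summable (\<lambda>m. \<bar>t\<bar> ^ (2 * m) / fact (2 * m) * measure sphere_measure (UNIV :: 'a set))"
    by (intro summable_mult2 summable_even_exp)
  have "(\<lambda>m. integral\<^sup>L sphere_measure (f m)) sums (LINT \<omega>|sphere_measure. (\<Sum>m. f m \<omega>))"
  proof (rule sums_integral[OF int])
    have "AE \<omega> in sphere_measure. \<forall>m. norm (f m \<omega>) \<le> \<bar>t\<bar> ^ (2 * m) / fact (2 * m)"
      using AEb by (simp add: AE_all_countable)
    then show "AE \<omega> in sphere_measure. summable (\<lambda>m. norm (f m \<omega>))"
      by (rule eventually_mono) (rule summable_comparison_test'[OF summable_even_exp[of t], where N = 0], simp)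
    show "summable (\<lambda>m. LINT \<omega>|sphere_measure. norm (f m \<omega>))"
    proof (rule summable_comparison_test'[OF sm, where N = 0])
      fix m :: nat
      have "(LINT \<omega>|sphere_measure. norm (f m \<omega>)) \<le> (LINT \<omega>|(sphere_measure :: 'a measure). \<bar>t\<bar> ^ (2 * m) / fact (2 * m))"
        using int AEb by (intro integral_mono_AE) auto
      then show "norm (LINT \<omega>|sphere_measure. norm (f m \<omega>)) \<le> \<bar>t\<bar> ^ (2 * m) / fact (2 * m) * measure sphere_measure (UNIV :: 'a set)"
        by (simp add: mult.commute)
    qed
  qed
  also have "(\<lambda>\<omega>. \<Sum>m. f m \<omega>) = (\<lambda>\<omega>. (\<omega> \<bullet> c) ^ (2 * j) * cos (t * (\<omega> \<bullet> e)))"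
    unfolding f_def by (intro ext sums_unique[symmetric] sums_mult cos_paired)
  also have "(\<lambda>m. integral\<^sup>L sphere_measure (f m)) = (\<lambda>m. ?C * ((-1) ^ m / fact m * rGamma (real m + \<nu> + 1) * (t / 2) ^ (2 * m)))"
  proof
    fix m
    have "integral\<^sup>L sphere_measure (f m) = (LINT \<omega>|sphere_measure. ((-1) ^ m / fact (2 * m) * t ^ (2 * m)) * ((\<omega> \<bullet> e) ^ (2 * m) * (\<omega> \<bullet> c) ^ (2 * j)))"
      unfolding f_def by (intro Bochner_Integration.integral_cong refl) (simp add: power_mult_distrib)
    also have "\<dots> = ((-1) ^ m / fact (2 * m) * t ^ (2 * m)) * (2 * Gamma (real m + 1/2) * Gamma (real j + 1/2) * sqrt pi ^ (DIM('a) - 2) * rGamma (real m + \<nu> + 1))"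
    proof -
      have arg: "real m + \<nu> + 1 = real m + real j + real DIM('a) / 2" by (simp add: \<nu>)
      show ?thesis
        by (simp only: integral_mult_right_zero sphere_two_moment[OF ec] arg rGamma_inverse_Gamma
          divide_inverse mult.assoc)
    qed
    also have "\<dots> = ?C * ((-1) ^ m / fact m * rGamma (real m + \<nu> + 1) * (t / 2) ^ (2 * m))"
    proof -
      \<comment> \<open>Two distinct basis vectors force dimension at least 2, so the truncated
        subtraction is exact. The additional factor sqrt pi is the one inside Gamma(m +
        1/2).\<close>
      have "card {e, c} \<le> DIM('a)" using ec by (intro card_mono) auto
      then have "DIM('a) - 1 = Suc (DIM('a) - 2)" using ec by simp
      then show ?thesis unfolding Gamma_nat_half[of m] by (simp add: power_divide mult_ac)
    qed
    finally show "integral\<^sup>L sphere_measure (f m) = ?C * ((-1) ^ m / fact m * rGamma (real m + \<nu> + 1) * (t / 2) ^ (2 * m))" .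
  qed
  finally have sums: "(\<lambda>m. ?C * ((-1) ^ m / fact m * rGamma (real m + \<nu> + 1) * (t / 2) ^ (2 * m))) sums ?I" .
  have "Gamma (real j + 1/2) > 0" by (intro Gamma_real_pos add_nonneg_pos) auto
  then have C: "?C \<noteq> 0" by (metis mult_eq_0_iff pi_neq_zero power_not_zero real_sqrt_eq_zero_cancel_iff less_irrefl zero_neq_numeral)
  have "(\<lambda>m. (-1) ^ m / fact m * rGamma (real m + \<nu> + 1) * (t / 2) ^ (2 * m)) sums (?I / ?C)"
    using sums_divide[OF sums, of ?C] unfolding nonzero_mult_div_cancel_left[OF C] .
  then have "bessel_J \<nu> t = (t / 2) powr \<nu> * (?I / ?C)"
    unfolding bessel_J_def by (simp add: sums_unique[symmetric])
  then have "bessel_J \<nu> t / (t / 2) powr \<nu> = ?I / ?C" using t by simp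
  with C show ?thesis by (simp only: times_divide_eq_right nonzero_mult_div_cancel_left not_False_eq_True)
qed

section \<open>Orthogonal invariance of the Lebesgue measure\<close>

lemma borel_measurable_linear:
  fixes f :: "'a::euclidean_space \<Rightarrow> 'a"
  assumes "linear f"
  shows "f \<in> borel_measurable borel"
  using linear_continuous_on[OF linear_conv_bounded_linear[THEN iffD1, OF assms]]
  by (rule borel_measurable_continuous_onI)

text \<open>A translation-invariant measure is a multiple of the Lebesgue measure (by Tonelli), and the
  unit ball, which \<open>f\<close> preserves, fixes the factor.\<close>

lemma lborel_distr_orthogonal:
  fixes f :: "'a::euclidean_space \<Rightarrow> 'a"
  assumes f: "orthogonal_transformation f"
  shows "distr lborel borel f = lborel"
proof (rule measure_eqI)
  have lin: "linear f" using f by (rule orthogonal_transformation_linear)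
  have [measurable]: "f \<in> borel_measurable borel" by (rule borel_measurable_linear[OF lin])
  define g where "g = inv f"
  have fg: "f (g y) = y" for y
    unfolding g_def using orthogonal_transformation_surj[OF f] by (rule surj_f_inv_f)
  have fx: "f (x - g y) = f x - y" for x y by (simp add: linear_diff[OF lin] fg)
  have shift: "(\<integral>\<^sup>+x. h (x + a) \<partial>lborel) = (\<integral>\<^sup>+x. h x \<partial>lborel)"
    if [measurable]: "h \<in> borel_measurable borel" for h :: "'a \<Rightarrow> ennreal" and a
  proof -
    have "(\<integral>\<^sup>+x. h x \<partial>lborel) = (\<integral>\<^sup>+x. h x \<partial>distr lborel borel (\<lambda>x. x + a))"
      using lborel_affine[of 1 a] by (simp add: density_1 add.commute)
    also have "\<dots> = (\<integral>\<^sup>+x. h (x + a) \<partial>lborel)" by (rule nn_integral_distr) auto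
    finally show ?thesis by simp
  qed
  have reflect: "(\<integral>\<^sup>+x. h (a - x) \<partial>lborel) = (\<integral>\<^sup>+x. h x \<partial>lborel)"
    if [measurable]: "h \<in> borel_measurable borel" for h :: "'a \<Rightarrow> ennreal" and a
  proof -
    have "(\<integral>\<^sup>+x. h x \<partial>lborel) = (\<integral>\<^sup>+x. h x \<partial>distr lborel borel (\<lambda>x. a - x))"
      using lborel_affine[of "-1" a] by (simp add: density_1)
    also have "\<dots> = (\<integral>\<^sup>+x. h (a - x) \<partial>lborel)" by (rule nn_integral_distr) auto
    finally show ?thesis by simp
  qed
  fix A assume "A \<in> sets (distr lborel borel f)"
  then have A[measurable]: "A \<in> sets borel" by simp
  let ?B = "ball (0::'a) 1"
  let ?\<mu> = "emeasure (distr lborel borel f)"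
  have Bm[measurable]: "?B \<in> sets borel" by (rule borel_open) simp
  define a b :: "'a \<Rightarrow> ennreal" where "a = indicator A" and "b = indicator ?B"
  have [measurable]: "a \<in> borel_measurable borel" "b \<in> borel_measurable borel"
    unfolding a_def b_def by (auto intro!: borel_measurable_indicator borel_open)
  have af: "?\<mu> A = (\<integral>\<^sup>+x. a (f x) \<partial>lborel)" and bf: "?\<mu> ?B = (\<integral>\<^sup>+x. b (f x) \<partial>lborel)"
    unfolding a_def b_def using A Bm by (simp_all flip: nn_integral_indicator add: nn_integral_distr)
  have "?\<mu> ?B = emeasure lborel (f -` ?B)" by (subst emeasure_distr) auto
  also have "f -` ?B = ?B"
    by (auto simp: orthogonal_transformation_norm[OF f])
  finally have B: "?\<mu> ?B = emeasure lborel ?B" .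
  \<comment> \<open>The uniqueness argument for Haar measure: the double integral of a(f x) b(y + f
    x) is evaluated in both orders. Translating x by -g y turns f x into f x - y and so moves the
    dependence on y from \<open>b\<close> to \<open>a\<close>.\<close>
  have "?\<mu> A * emeasure lborel ?B = (\<integral>\<^sup>+x. a (f x) * (\<integral>\<^sup>+y. b y \<partial>lborel) \<partial>lborel)"
    unfolding af by (simp add: nn_integral_multc b_def)
  also have "\<dots> = (\<integral>\<^sup>+x. \<integral>\<^sup>+y. a (f x) * b (y + f x) \<partial>lborel \<partial>lborel)"
    by (simp add: nn_integral_cmult shift)
  also have "\<dots> = (\<integral>\<^sup>+y. \<integral>\<^sup>+x. a (f x) * b (y + f x) \<partial>lborel \<partial>lborel)"
    by (rule lborel_pair.Fubini'[symmetric]) measurable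
  also have "\<dots> = (\<integral>\<^sup>+y. \<integral>\<^sup>+x. a (f (x - g y)) * b (y + f (x - g y)) \<partial>lborel \<partial>lborel)"
  proof (rule nn_integral_cong)
    fix y
    show "(\<integral>\<^sup>+x. a (f x) * b (y + f x) \<partial>lborel) = (\<integral>\<^sup>+x. a (f (x - g y)) * b (y + f (x - g y)) \<partial>lborel)"
      using shift[of "\<lambda>x. a (f x) * b (y + f x)" "- g y"] by simp
  qed
  also have "\<dots> = (\<integral>\<^sup>+y. \<integral>\<^sup>+x. a (f x - y) * b (f x) \<partial>lborel \<partial>lborel)"
    by (simp add: fx)
  also have "\<dots> = (\<integral>\<^sup>+x. \<integral>\<^sup>+y. a (f x - y) * b (f x) \<partial>lborel \<partial>lborel)"
    by (rule lborel_pair.Fubini') measurable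
  also have "\<dots> = (\<integral>\<^sup>+x. (\<integral>\<^sup>+y. a y \<partial>lborel) * b (f x) \<partial>lborel)"
    by (simp add: nn_integral_multc reflect)
  also have "\<dots> = emeasure lborel A * ?\<mu> ?B"
    unfolding bf by (simp add: nn_integral_cmult a_def)
  finally have "emeasure lborel ?B * ?\<mu> A = emeasure lborel ?B * emeasure lborel A"
    unfolding B by (simp only: mult.commute)
  moreover have "emeasure lborel ?B \<noteq> 0" "emeasure lborel ?B \<noteq> \<infinity>"
    using unit_ball_vol_pos[of "real DIM('a)"] emeasure_bounded_finite[of ?B]
    by (auto simp: emeasure_ball ennreal_eq_0_iff not_le)
  ultimately show "?\<mu> A = emeasure lborel A"
    by (simp add: ennreal_mult_cancel_left)
qed simp

lemma integral_orthogonal: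
  fixes f :: "'a::euclidean_space \<Rightarrow> 'a" and F :: "'a \<Rightarrow> real"
  assumes f: "orthogonal_transformation f" and F[measurable]: "F \<in> borel_measurable borel"
  shows "(LINT x|lborel. F (f x)) = (LINT x|lborel. F x)"
proof -
  have [measurable]: "f \<in> borel_measurable borel"
    by (rule borel_measurable_linear[OF orthogonal_transformation_linear[OF f]])
  have "(LINT x|lborel. F (f x)) = (LINT x|distr lborel borel f. F x)"
    by (rule integral_distr[symmetric]) auto
  then show ?thesis by (simp only: lborel_distr_orthogonal[OF f])
qed

lemma orthogonal_reflection:
  assumes "norm (b::'a::euclidean_space) = 1"
  shows "orthogonal_transformation (\<lambda>x. x - (2 * (x \<bullet> b)) *\<^sub>R b)"
proof -
  have "b \<bullet> b = 1" using assms by (simp add: norm_eq_1)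
  then show ?thesis
    unfolding orthogonal_transformation_def
    by (auto intro!: linearI simp: inner_diff_left inner_diff_right inner_add_left algebra_simps
      inner_commute scaleR_add_left)
qed

section \<open>Radial Fourier integrals\<close>

lemma borel_measurable_bessel_J[measurable]: "bessel_J \<nu> \<in> borel_measurable borel"
  unfolding bessel_J_def[abs_def] by measurable

text \<open>\<open>hpar\<close> and \<open>hperp\<close> combine the cases
  \<open>hankel \<mu> (\<mu> + 1)\<close> and \<open>hankel (\<mu> + 1) \<mu>\<close>. The measure
  is \<open>lborel\<close>, as Borel representatives will stand in for the profiles.\<close>

definition hankel :: "real \<Rightarrow> real \<Rightarrow> real \<Rightarrow> (real \<Rightarrow> real) \<Rightarrow> real"
  where "hankel \<nu> s \<rho> f = (LINT r|lborel. indicator {0<..} r * (r powr s * f r * bessel_J \<nu> (2 * pi * \<rho> * r)))"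

lemma norm_sgn_le: "norm (sgn (x::'a::real_normed_vector)) \<le> 1"
  by (simp add: norm_sgn)

text \<open>The factor r^(d-1) of polar coordinates loses \<open>r powr \<nu>\<close> to the
  normalization in \<open>sphere_cos\<close>, which explains the exponent d - 1 - \<nu>; the other
  part, \<open>(pi * \<rho>) powr \<nu>\<close>, leaves the integral. The weight is taken along an
  axis \<open>c\<close> orthogonal to the frequency axis \<open>e\<close>.\<close>

lemma radial_transform:
  fixes e c :: "'a::euclidean_space" and f :: "real \<Rightarrow> real"
  assumes ec: "e \<in> Basis" "c \<in> Basis" "e \<noteq> c" and \<rho>: "\<rho> > 0"
    and \<nu>: "\<nu> = real j + real DIM('a) / 2 - 1"
    and f[measurable]: "f \<in> borel_measurable borel"
    and int: "integrable lborel (\<lambda>x::'a. f (norm x))"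
  shows "(LINT x|lborel. f (norm x) * (sgn x \<bullet> c) ^ (2 * j) * cos (2 * pi * \<rho> * (x \<bullet> e)))
    = 2 * Gamma (real j + 1/2) * sqrt pi ^ (DIM('a) - 1) / (pi * \<rho>) powr \<nu> * hankel \<nu> (real DIM('a) - 1 - \<nu>) \<rho> f"
proof -
  let ?C = "2 * Gamma (real j + 1/2) * sqrt pi ^ (DIM('a) - 1)"
  define F where "F r \<omega> = f r * ((\<omega> \<bullet> c) ^ (2 * j) * cos ((2 * pi * \<rho> * r) * (\<omega> \<bullet> e)))" for r and \<omega> :: 'a
  have F: "F (norm x) (sgn x) = f (norm x) * (sgn x \<bullet> c) ^ (2 * j) * cos (2 * pi * \<rho> * (x \<bullet> e))" for x
  proof -
    have "norm x * (sgn x \<bullet> e) = x \<bullet> e" by (cases "x = 0") (auto simp: sgn_div_norm)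
    then have "2 * pi * \<rho> * norm x * (sgn x \<bullet> e) = 2 * pi * \<rho> * (x \<bullet> e)" by (simp only: mult.assoc)
    then show ?thesis unfolding F_def by (simp only: mult.assoc)
  qed
  have Fm[measurable]: "(\<lambda>(r, \<omega>). F r \<omega>) \<in> borel_measurable (borel \<Otimes>\<^sub>M borel)"
    unfolding F_def by measurable
  have "integrable lborel (\<lambda>x. F (norm x) (sgn x))"
  proof (rule Bochner_Integration.integrable_bound[OF int])
    have "norm (F (norm x) (sgn x)) \<le> norm (f (norm x))" for x
    proof -
      have "\<bar>sgn x \<bullet> c\<bar> \<le> 1" using ec Basis_le_norm[of c "sgn x"] norm_sgn_le[of x] by linarith
      then have "\<bar>sgn x \<bullet> c\<bar> ^ (2 * j) * \<bar>cos (2 * pi * \<rho> * norm x * (sgn x \<bullet> e))\<bar> \<le> 1 * 1"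
        by (intro mult_mono) (auto intro!: power_le_one)
      then have "\<bar>f (norm x)\<bar> * (\<bar>sgn x \<bullet> c\<bar> ^ (2 * j) * \<bar>cos (2 * pi * \<rho> * norm x * (sgn x \<bullet> e))\<bar>) \<le> \<bar>f (norm x)\<bar> * 1"
        by (intro mult_left_mono) auto
      then show ?thesis unfolding F_def by (simp add: abs_mult power_abs)
    qed
    then show "AE x in lborel. norm (F (norm x) (sgn x)) \<le> norm (f (norm x))" by simp
  qed measurable
  then have "(LINT x|lborel. F (norm x) (sgn x))
     = (LINT r|lborel. indicator {0<..} r * r ^ (DIM('a) - 1) * (LINT \<omega>|sphere_measure. F r \<omega>))"
    by (rule polar_integral[OF Fm])
  also have "\<dots> = (LINT r|lborel. ?C / (pi * \<rho>) powr \<nu> *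
      (indicator {0<..} r * (r powr (real DIM('a) - 1 - \<nu>) * f r * bessel_J \<nu> (2 * pi * \<rho> * r))))"
  proof (intro Bochner_Integration.integral_cong refl)
    fix r :: real
    show "indicator {0<..} r * r ^ (DIM('a) - 1) * (LINT \<omega>|sphere_measure. F r \<omega>) =
      ?C / (pi * \<rho>) powr \<nu> * (indicator {0<..} r * (r powr (real DIM('a) - 1 - \<nu>) * f r * bessel_J \<nu> (2 * pi * \<rho> * r)))"
    proof (cases "r > 0")
      case True
      have t: "2 * pi * \<rho> * r > 0" using True \<rho> by simp
      have "(LINT \<omega>|sphere_measure. F r \<omega>) = f r * (?C * (bessel_J \<nu> (2 * pi * \<rho> * r) / (2 * pi * \<rho> * r / 2) powr \<nu>))"
        unfolding F_def integral_mult_right_zero sphere_cos[OF ec t \<nu>] ..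
      moreover have "(2 * pi * \<rho> * r / 2) powr \<nu> = (pi * \<rho>) powr \<nu> * r powr \<nu>"
        using True \<rho> by (simp add: powr_mult)
      moreover have "r powr (real DIM('a) - 1 - \<nu>) = r ^ (DIM('a) - 1) / r powr \<nu>"
        using True DIM_positive[where 'a='a] by (simp add: powr_diff powr_realpow[symmetric] of_nat_diff Suc_leI)
      ultimately show ?thesis using True by simp
    qed simp
  qed
  also have "\<dots> = ?C / (pi * \<rho>) powr \<nu> * hankel \<nu> (real DIM('a) - 1 - \<nu>) \<rho> f"
    unfolding hankel_def by simp
  finally show ?thesis unfolding F .
qed

lemma sqrt_pi_power: "sqrt pi ^ n = pi powr (real n / 2)"
  by (simp add: powr_half_sqrt[symmetric] powr_powr flip: powr_realpow)

text \<open>The cases j = 0 and j = 1, of orders \<mu> and \<mu> + 1. The d-th power of sqrt pi is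
  \<open>pi powr (\<mu> + 1)\<close>, which leaves one factor pi in the first case and none in the
  second, where Gamma(3/2) = sqrt pi/2 also removes the 2.\<close>

lemma fourier_radial:
  fixes e c :: "'a::euclidean_space" and f :: "real \<Rightarrow> real"
  assumes ec: "e \<in> Basis" "c \<in> Basis" "e \<noteq> c" and \<rho>: "\<rho> > 0"
    and \<mu>: "\<mu> = real DIM('a) / 2 - 1"
    and f[measurable]: "f \<in> borel_measurable borel"
    and int: "integrable lborel (\<lambda>x::'a. f (norm x))"
  shows "(LINT x|lborel. f (norm x) * cos (2 * pi * \<rho> * (x \<bullet> e))) = 2 * pi / \<rho> powr \<mu> * hankel \<mu> (\<mu> + 1) \<rho> f"
    and "(LINT x|lborel. f (norm x) * (sgn x \<bullet> c)\<^sup>2 * cos (2 * pi * \<rho> * (x \<bullet> e)))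
      = 1 / \<rho> powr (\<mu> + 1) * hankel (\<mu> + 1) \<mu> \<rho> f"
proof -
  have d: "sqrt pi * sqrt pi ^ (DIM('a) - 1) = pi powr (\<mu> + 1)"
    unfolding power_Suc[symmetric] using DIM_positive[where 'a='a] by (simp add: sqrt_pi_power \<mu>)
  have s: "real DIM('a) - 1 - \<mu> = \<mu> + 1" "real DIM('a) - 1 - (\<mu> + 1) = \<mu>" by (simp_all add: \<mu>)
  have G: "Gamma (1/2) = sqrt pi" "Gamma (1 + 1/2) = sqrt pi / 2"
    using Gamma_nat_half[of 1] by (simp_all add: Gamma_one_half_real)
  have 0: "\<mu> = real 0 + real DIM('a) / 2 - 1" and 1: "\<mu> + 1 = real 1 + real DIM('a) / 2 - 1" by (simp_all add: \<mu>)
  have "2 * Gamma (real 0 + 1/2) * sqrt pi ^ (DIM('a) - 1) / (pi * \<rho>) powr \<mu> = 2 * (sqrt pi * sqrt pi ^ (DIM('a) - 1)) / (pi * \<rho>) powr \<mu>"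
    by (simp add: G)
  also have "\<dots> = 2 * pi / \<rho> powr \<mu>"
    unfolding d using \<rho> by (simp add: powr_mult powr_add)
  finally show "(LINT x|lborel. f (norm x) * cos (2 * pi * \<rho> * (x \<bullet> e))) = 2 * pi / \<rho> powr \<mu> * hankel \<mu> (\<mu> + 1) \<rho> f"
    using radial_transform[OF ec \<rho> 0 f int] unfolding s by simp
  have "2 * Gamma (real 1 + 1/2) * sqrt pi ^ (DIM('a) - 1) / (pi * \<rho>) powr (\<mu> + 1) = (sqrt pi * sqrt pi ^ (DIM('a) - 1)) / (pi * \<rho>) powr (\<mu> + 1)"
    using G(2) by simp
  also have "\<dots> = 1 / \<rho> powr (\<mu> + 1)"
    unfolding d using \<rho> by (simp add: powr_mult)
  finally show "(LINT x|lborel. f (norm x) * (sgn x \<bullet> c)\<^sup>2 * cos (2 * pi * \<rho> * (x \<bullet> e)))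
      = 1 / \<rho> powr (\<mu> + 1) * hankel (\<mu> + 1) \<mu> \<rho> f"
    using radial_transform[OF ec \<rho> 1 f int] unfolding s by simp
qed

lemma integrable_radial_bounded:
  fixes f :: "real \<Rightarrow> real" and g :: "'a::euclidean_space \<Rightarrow> real"
  assumes int: "integrable lborel (\<lambda>x::'a. f (norm x))"
    and [measurable]: "g \<in> borel_measurable borel" "f \<in> borel_measurable borel" and "\<And>x. \<bar>g x\<bar> \<le> B"
  shows "integrable lborel (\<lambda>x. f (norm x) * g x)"
proof (rule Bochner_Integration.integrable_bound)
  show "integrable lborel (\<lambda>x::'a. B * f (norm x))" using int by simp
  have "\<bar>f (norm x)\<bar> * \<bar>g x\<bar> \<le> \<bar>f (norm x)\<bar> * \<bar>B\<bar>" for x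
    using assms(4)[of x] by (intro mult_left_mono) auto
  then show "AE x in lborel. norm (f (norm x) * g x) \<le> norm (B * f (norm x))"
    by (simp add: abs_mult mult.commute)
qed measurable

text \<open>Only D = p - q is anisotropic, and its transform weighted by pairs of components of
  \<open>sgn x\<close> is a diagonal matrix: \<open>B\<close> on each of the d - 1 axes orthogonal
  to \<open>e\<close>, and on \<open>e\<close> whatever the trace leaves. The trace is the scalar
  transform of D, so along \<open>e\<close> the contributions of q cancel and that of p
  remains.\<close>

lemma fourier_quadratic_axis:
  fixes e w :: "'a::euclidean_space" and p q :: "real \<Rightarrow> real"
  assumes dim: "DIM('a) \<ge> 2" and e: "e \<in> Basis" and \<rho>: "\<rho> > 0" and \<mu>: "\<mu> = real DIM('a) / 2 - 1"
    and [measurable]: "p \<in> borel_measurable borel" "q \<in> borel_measurable borel"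
    and ip: "integrable lborel (\<lambda>x::'a. p (norm x))" and iq: "integrable lborel (\<lambda>x::'a. q (norm x))"
  shows "(LINT x|lborel. (q (norm x) * (norm w)\<^sup>2 + (p (norm x) - q (norm x)) * (w \<bullet> sgn x)\<^sup>2) * cos (2 * pi * \<rho> * (x \<bullet> e)))
    = (2 * pi / \<rho> powr \<mu> * hankel \<mu> (\<mu> + 1) \<rho> p
        - (2 * \<mu> + 1) / \<rho> powr (\<mu> + 1) * hankel (\<mu> + 1) \<mu> \<rho> (\<lambda>r. p r - q r)) * (w \<bullet> e)\<^sup>2
    + (2 * pi / \<rho> powr \<mu> * hankel \<mu> (\<mu> + 1) \<rho> q
        + 1 / \<rho> powr (\<mu> + 1) * hankel (\<mu> + 1) \<mu> \<rho> (\<lambda>r. p r - q r)) * ((norm w)\<^sup>2 - (w \<bullet> e)\<^sup>2)"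
proof -
  define D where "D r = p r - q r" for r
  have [measurable]: "D \<in> borel_measurable borel" unfolding D_def[abs_def] by measurable
  have iD: "integrable lborel (\<lambda>x::'a. D (norm x))" using ip iq unfolding D_def by simp
  define C where "C x = cos (2 * pi * \<rho> * (x \<bullet> e))" for x
  have [measurable]: "C \<in> borel_measurable borel" unfolding C_def[abs_def] by measurable
  define M where "M b c = (LINT x|lborel. D (norm x) * (sgn x \<bullet> b) * (sgn x \<bullet> c) * C x)" for b c :: 'a
  define B where "B = 1 / \<rho> powr (\<mu> + 1) * hankel (\<mu> + 1) \<mu> \<rho> D"
  \<comment> \<open>\<open>fourier_radial\<close> asks for an auxiliary axis other than
    \<open>e\<close>; it exists because the dimension is at least 2.\<close>
  obtain c0 where c0: "c0 \<in> Basis" "e \<noteq> c0"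
  proof -
    have "\<not> (Basis :: 'a set) \<subseteq> {e}" using dim card_mono[of "{e}" "Basis :: 'a set"] by auto
    then show ?thesis using that by blast
  qed
  have bnd: "\<bar>(sgn x \<bullet> b) * (sgn x \<bullet> c) * C x\<bar> \<le> 1" if "b \<in> Basis" "c \<in> Basis" for x b c
  proof -
    have "\<bar>sgn x \<bullet> b\<bar> \<le> 1" "\<bar>sgn x \<bullet> c\<bar> \<le> 1"
      using that Basis_le_norm[of b "sgn x"] Basis_le_norm[of c "sgn x"] norm_sgn_le[of x] by linarith+
    then have "\<bar>sgn x \<bullet> b\<bar> * \<bar>sgn x \<bullet> c\<bar> * \<bar>C x\<bar> \<le> 1 * 1 * 1"
      by (intro mult_mono) (auto simp: C_def)
    then show ?thesis by (simp add: abs_mult)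
  qed
  have iM: "integrable lborel (\<lambda>x. D (norm x) * (sgn x \<bullet> b) * (sgn x \<bullet> c) * C x)" if "b \<in> Basis" "c \<in> Basis" for b c
    unfolding mult.assoc[of "D _"] using bnd[OF that] by (intro integrable_radial_bounded[OF iD]) auto
  have off: "M b c = 0" if bc: "b \<in> Basis" "c \<in> Basis" "b \<noteq> c" "b \<noteq> e" for b c
  proof -
    define T where "T x = x - (2 * (x \<bullet> b)) *\<^sub>R b" for x :: 'a
    have T: "orthogonal_transformation T"
      unfolding T_def[abs_def] using bc by (intro orthogonal_reflection) simp
    have nT: "norm (T x) = norm x" for x using T by (rule orthogonal_transformation_norm)
    have sT: "sgn (T x) = T (sgn x)" for x
      by (simp add: sgn_div_norm nT orthogonal_transformation_scaleR[OF T])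
    have Tb: "T x \<bullet> b = - (x \<bullet> b)" "T x \<bullet> c = x \<bullet> c" "T x \<bullet> e = x \<bullet> e" for x
      using bc e by (auto simp: T_def inner_diff_left inner_Basis)
    have "M b c = (LINT x|lborel. D (norm (T x)) * (sgn (T x) \<bullet> b) * (sgn (T x) \<bullet> c) * C (T x))"
      unfolding M_def by (rule integral_orthogonal[OF T, symmetric]) measurable
    also have "\<dots> = - M b c"
      unfolding M_def nT sT C_def Tb by simp
    finally show ?thesis by simp
  qed
  \<comment> \<open>The reflection has to fix the cosine and so cannot be along \<open>e\<close>. If
    b = e, the symmetry of \<open>M\<close> allows a reflection along c instead.\<close>
  have off': "M b c = 0" if "b \<in> Basis" "c \<in> Basis" "b \<noteq> c" for b c
  proof (cases "b = e")
    case True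
    have "M b c = M c b" unfolding M_def by (simp add: mult_ac)
    then show ?thesis using off[of c b] that True by simp
  qed (use off that in auto)
  have diag: "M c c = B" if "c \<in> Basis" "c \<noteq> e" for c
    using fourier_radial(2)[OF e that(1) that(2)[symmetric] \<rho> \<mu> _ iD]
    unfolding M_def B_def C_def by (simp add: power2_eq_square mult.assoc)
  \<comment> \<open>The squared components of \<open>sgn x\<close> do not sum to 1 at the
    origin.\<close>
  have ae: "AE x in lborel. (x::'a) \<noteq> 0" using AE_lborel_singleton[of "0::'a"] by simp
  have sumM: "(\<Sum>c\<in>Basis. M c c) = (LINT x|lborel. D (norm x) * C x)"
  proof -
    have "(\<Sum>c\<in>Basis. M c c) = (LINT x|lborel. (\<Sum>c\<in>Basis. D (norm x) * (sgn x \<bullet> c) * (sgn x \<bullet> c) * C x))"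
      unfolding M_def by (rule Bochner_Integration.integral_sum[symmetric]) (rule iM)
    also have "\<dots> = (LINT x|lborel. D (norm x) * C x)"
    proof (rule integral_cong_AE)
      show "AE x in lborel. (\<Sum>c\<in>Basis. D (norm x) * (sgn x \<bullet> c) * (sgn x \<bullet> c) * C x) = D (norm x) * C x"
        using ae
      proof eventually_elim
        case (elim x)
        have "(\<Sum>c\<in>Basis. (sgn x \<bullet> c) * (sgn x \<bullet> c)) = 1"
          unfolding euclidean_inner[of "sgn x" "sgn x", symmetric] power2_norm_eq_inner[symmetric]
          using elim by (simp add: norm_sgn)
        then have "D (norm x) * (\<Sum>c\<in>Basis. (sgn x \<bullet> c) * (sgn x \<bullet> c)) * C x = D (norm x) * C x" by simp
        then show ?case by (simp add: sum_distrib_left sum_distrib_right mult.assoc)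
      qed
    qed measurable
    finally show ?thesis .
  qed
  have cosine: "(LINT x|lborel. h (norm x) * C x) = 2 * pi / \<rho> powr \<mu> * hankel \<mu> (\<mu> + 1) \<rho> h"
    if "h \<in> borel_measurable borel" "integrable lborel (\<lambda>x::'a. h (norm x))" for h
    unfolding C_def by (rule fourier_radial(1)[OF e c0 \<rho> \<mu> that])
  have Mee: "M e e = (LINT x|lborel. D (norm x) * C x) - (2 * \<mu> + 1) * B"
  proof -
    have "(\<Sum>c\<in>Basis. M c c) = M e e + (\<Sum>c\<in>Basis - {e}. M c c)"
      using e by (intro sum.remove) auto
    also have "(\<Sum>c\<in>Basis - {e}. M c c) = (\<Sum>c\<in>Basis - {e}. B)"
      by (intro sum.cong) (auto simp: diag)
    also have "\<dots> = (2 * \<mu> + 1) * B"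
      using e DIM_positive[where 'a='a] by (simp add: \<mu> of_nat_diff Suc_leI)
    finally show ?thesis using sumM by simp
  qed
  have quad: "(w \<bullet> sgn x)\<^sup>2 = (\<Sum>b\<in>Basis. \<Sum>c\<in>Basis. (w \<bullet> b) * (w \<bullet> c) * ((sgn x \<bullet> b) * (sgn x \<bullet> c)))" for x
    unfolding power2_eq_square by (subst (1 2) euclidean_inner) (simp add: sum_product mult_ac)
  have "(LINT x|lborel. D (norm x) * (w \<bullet> sgn x)\<^sup>2 * C x)
    = (LINT x|lborel. (\<Sum>b\<in>Basis. \<Sum>c\<in>Basis. (w \<bullet> b) * (w \<bullet> c) * (D (norm x) * (sgn x \<bullet> b) * (sgn x \<bullet> c) * C x)))"
    unfolding quad by (simp add: sum_distrib_left sum_distrib_right mult_ac)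
  also have "\<dots> = (\<Sum>b\<in>Basis. LINT x|lborel. (\<Sum>c\<in>Basis. (w \<bullet> b) * (w \<bullet> c) * (D (norm x) * (sgn x \<bullet> b) * (sgn x \<bullet> c) * C x)))"
    by (intro Bochner_Integration.integral_sum Bochner_Integration.integrable_sum integrable_mult_right iM)
  also have "\<dots> = (\<Sum>b\<in>Basis. \<Sum>c\<in>Basis. LINT x|lborel. (w \<bullet> b) * (w \<bullet> c) * (D (norm x) * (sgn x \<bullet> b) * (sgn x \<bullet> c) * C x))"
    by (intro sum.cong refl Bochner_Integration.integral_sum integrable_mult_right iM)
  also have "\<dots> = (\<Sum>b\<in>Basis. \<Sum>c\<in>Basis. (w \<bullet> b) * (w \<bullet> c) * M b c)"
    unfolding M_def by simp
  also have "\<dots> = (\<Sum>b\<in>Basis. (w \<bullet> b)\<^sup>2 * M b b)"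
  proof (rule sum.cong[OF refl])
    fix b :: 'a assume b: "b \<in> Basis"
    have "(\<Sum>c\<in>Basis. (w \<bullet> b) * (w \<bullet> c) * M b c) = (\<Sum>c\<in>Basis. if c = b then (w \<bullet> b)\<^sup>2 * M b b else 0)"
      using b by (intro sum.cong) (auto simp: off' power2_eq_square)
    then show "(\<Sum>c\<in>Basis. (w \<bullet> b) * (w \<bullet> c) * M b c) = (w \<bullet> b)\<^sup>2 * M b b" using b by simp
  qed
  also have "\<dots> = (w \<bullet> e)\<^sup>2 * M e e + (\<Sum>b\<in>Basis - {e}. (w \<bullet> b)\<^sup>2 * M b b)"
    using e by (intro sum.remove) auto
  also have "(\<Sum>b\<in>Basis - {e}. (w \<bullet> b)\<^sup>2 * M b b) = (\<Sum>b\<in>Basis - {e}. (w \<bullet> b)\<^sup>2) * B"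
    unfolding sum_distrib_right by (intro sum.cong) (auto simp: diag)
  also have "(\<Sum>b\<in>Basis - {e}. (w \<bullet> b)\<^sup>2) = (norm w)\<^sup>2 - (w \<bullet> e)\<^sup>2"
  proof -
    have "(norm w)\<^sup>2 = (\<Sum>b\<in>Basis. (w \<bullet> b)\<^sup>2)"
      unfolding power2_norm_eq_inner by (subst euclidean_inner) (simp add: power2_eq_square)
    then show ?thesis using e by (simp add: sum_diff1)
  qed
  finally have Dint: "(LINT x|lborel. D (norm x) * (w \<bullet> sgn x)\<^sup>2 * C x) = (w \<bullet> e)\<^sup>2 * M e e + ((norm w)\<^sup>2 - (w \<bullet> e)\<^sup>2) * B" .
  have wb: "\<bar>(w \<bullet> sgn x)\<^sup>2 * C x\<bar> \<le> (norm w)\<^sup>2" for x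
  proof -
    have "\<bar>w \<bullet> sgn x\<bar> \<le> norm w * 1"
      using Cauchy_Schwarz_ineq2[of w "sgn x"] mult_left_mono[OF norm_sgn_le[of x], of "norm w"] by simp
    then have "(w \<bullet> sgn x)\<^sup>2 \<le> (norm w)\<^sup>2" by (simp add: abs_le_square_iff[symmetric])
    then have "(w \<bullet> sgn x)\<^sup>2 * \<bar>C x\<bar> \<le> (norm w)\<^sup>2 * 1"
      by (intro mult_mono) (auto simp: C_def)
    then show ?thesis by (simp add: abs_mult)
  qed
  have iDw: "integrable lborel (\<lambda>x. D (norm x) * (w \<bullet> sgn x)\<^sup>2 * C x)"
    unfolding mult.assoc[of "D _"] using wb by (intro integrable_radial_bounded[OF iD]) auto
  have iqC: "integrable lborel (\<lambda>x. q (norm x) * C x)" "integrable lborel (\<lambda>x. p (norm x) * C x)"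
    by (intro integrable_radial_bounded[OF iq, where B = 1] integrable_radial_bounded[OF ip, where B = 1];
      simp add: C_def)+
  have "(LINT x|lborel. (q (norm x) * (norm w)\<^sup>2 + (p (norm x) - q (norm x)) * (w \<bullet> sgn x)\<^sup>2) * C x)
    = (LINT x|lborel. (norm w)\<^sup>2 * (q (norm x) * C x) + D (norm x) * (w \<bullet> sgn x)\<^sup>2 * C x)"
    by (intro Bochner_Integration.integral_cong refl) (simp add: D_def algebra_simps)
  also have "\<dots> = (norm w)\<^sup>2 * (LINT x|lborel. q (norm x) * C x) + (LINT x|lborel. D (norm x) * (w \<bullet> sgn x)\<^sup>2 * C x)"
    using iqC iDw by simp
  also have "\<dots> = (LINT x|lborel. q (norm x) * C x) * (norm w)\<^sup>2
     + (w \<bullet> e)\<^sup>2 * ((LINT x|lborel. p (norm x) * C x) - (LINT x|lborel. q (norm x) * C x) - (2 * \<mu> + 1) * B)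
     + ((norm w)\<^sup>2 - (w \<bullet> e)\<^sup>2) * B"
    unfolding Dint Mee using iqC by (simp add: D_def left_diff_distrib)
  also have "\<dots> = ((LINT x|lborel. p (norm x) * C x) - (2 * \<mu> + 1) * B) * (w \<bullet> e)\<^sup>2
     + ((LINT x|lborel. q (norm x) * C x) + B) * ((norm w)\<^sup>2 - (w \<bullet> e)\<^sup>2)"
    by (simp add: algebra_simps)
  finally show ?thesis
    unfolding cosine[OF \<open>p \<in> borel_measurable borel\<close> ip] cosine[OF \<open>q \<in> borel_measurable borel\<close> iq]
    unfolding B_def C_def D_def[abs_def] by simp
qed

section \<open>Positive definiteness from a nonnegative Fourier transform\<close>

lemma power_times_gaussian_tendsto_0:
  assumes "\<delta> > 0"
  shows "(\<lambda>n. real (Suc n) ^ d * exp (- (real (Suc n) * \<delta>)\<^sup>2 / 2)) \<longlonglongrightarrow> 0"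
proof -
  define c where "c = \<delta>\<^sup>2 / 2"
  have c: "c > 0" unfolding c_def using assms by simp
  have "filterlim (\<lambda>n. c * real (Suc n)) at_top sequentially"
    by (intro filterlim_tendsto_pos_mult_at_top[OF tendsto_const c]
      filterlim_compose[OF filterlim_real_sequentially filterlim_Suc])
  then have "(\<lambda>n. (c * real (Suc n)) ^ d / exp (c * real (Suc n))) \<longlonglongrightarrow> 0"
    by (rule filterlim_compose[OF tendsto_power_div_exp_0])
  then have "(\<lambda>n. 1 / c ^ d * ((c * real (Suc n)) ^ d / exp (c * real (Suc n)))) \<longlonglongrightarrow> 1 / c ^ d * 0"
    by (rule tendsto_mult_left)
  then have lim: "(\<lambda>n. 1 / c ^ d * ((c * real (Suc n)) ^ d / exp (c * real (Suc n)))) \<longlonglongrightarrow> 0"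
    by simp
  have "real (Suc n) ^ d * exp (- (real (Suc n) * \<delta>)\<^sup>2 / 2)
      \<le> 1 / c ^ d * ((c * real (Suc n)) ^ d / exp (c * real (Suc n)))" for n
  proof -
    \<comment> \<open>A number that is at least 1 is dominated by its square; this weakens the
      Gaussian decay to exp(-c (n + 1)) and reduces the limit to a power over an
      exponential.\<close>
    have "c * real (Suc n) * 1 \<le> c * real (Suc n) * real (Suc n)"
      using c by (intro mult_left_mono) auto
    then have "c * real (Suc n) \<le> (real (Suc n) * \<delta>)\<^sup>2 / 2"
      unfolding c_def by (simp only: power_mult_distrib power2_eq_square mult_ac mult_1_right times_divide_eq_left times_divide_eq_right)
    then have "real (Suc n) ^ d * exp (- (real (Suc n) * \<delta>)\<^sup>2 / 2) \<le> real (Suc n) ^ d * exp (- (c * real (Suc n)))"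
      by (intro mult_left_mono) auto
    also have "\<dots> = 1 / c ^ d * ((c * real (Suc n)) ^ d / exp (c * real (Suc n)))"
      using c by (simp only: power_mult_distrib exp_minus) (simp add: field_simps del: of_nat_Suc)
    finally show ?thesis .
  qed
  then have ev: "eventually (\<lambda>n. real (Suc n) ^ d * exp (- (real (Suc n) * \<delta>)\<^sup>2 / 2)
      \<le> 1 / c ^ d * ((c * real (Suc n)) ^ d / exp (c * real (Suc n)))) sequentially"
    by simp
  show ?thesis
    by (rule tendsto_sandwich[OF _ ev tendsto_const lim]) simp
qed

text \<open>\<open>f\<close> is integrable and continuous at the single point \<open>z\<close>, so
  it may be unbounded elsewhere. On a small ball it is bounded, and the rescaled integrals converge
  by domination. Outside, with s = n + 1, the normalized kernel is at most a constant times s^d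
  exp(-(s \<delta>)^2/2), which tends to 0 against the L1 norm of \<open>f\<close>.\<close>

lemma gauss_approximate_identity:
  fixes f :: "'a::euclidean_space \<Rightarrow> real"
  assumes f: "integrable lborel f" and cont: "isCont f z"
  shows "(\<lambda>n. real (Suc n) ^ DIM('a) * (LINT y|lborel. f y * gauss (real (Suc n) *\<^sub>R (z - y)))) \<longlonglongrightarrow> f z"
proof -
  have [measurable]: "f \<in> borel_measurable borel" using f by auto
  \<comment> \<open>The tolerance 1 is an arbitrary choice; it yields the bound |f z| + 1 on the
    ball.\<close>
  obtain \<delta> where \<delta>: "\<delta> > 0" "\<And>y. dist y z < \<delta> \<Longrightarrow> dist (f y) (f z) < 1"
    using cont unfolding continuous_at_eps_delta by (metis zero_less_one)
  define f1 where "f1 y = indicator (ball z \<delta>) y * f y" for y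
  define f2 where "f2 y = f y - f1 y" for y
  have [measurable]: "ball z \<delta> \<in> sets borel" by (rule borel_open) simp
  have m1[measurable]: "f1 \<in> borel_measurable borel" unfolding f1_def[abs_def] by measurable
  have m2[measurable]: "f2 \<in> borel_measurable borel" unfolding f2_def[abs_def] by measurable
  have f2: "\<bar>f2 y\<bar> \<le> \<bar>f y\<bar>" "dist z y < \<delta> \<Longrightarrow> f2 y = 0" for y
    by (auto simp: f2_def f1_def split: split_indicator)
  have f1: "\<bar>f1 y\<bar> \<le> \<bar>f z\<bar> + 1" for y
    using \<delta>(2)[of y] by (auto simp: f1_def dist_real_def dist_commute split: split_indicator)
  have i1: "integrable lborel f1"
    by (rule Bochner_Integration.integrable_bound[OF f]) (auto simp: f1_def split: split_indicator)
  have i2: "integrable lborel f2" unfolding f2_def[abs_def] using f i1 by simp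
  have ig: "integrable lborel (\<lambda>y. h y * gauss (c *\<^sub>R (z - y)))" if "integrable lborel h" for h :: "'a \<Rightarrow> real" and c
  proof (rule Bochner_Integration.integrable_bound)
    show "integrable lborel (\<lambda>y. gauss (0::'a) * h y)" using that by simp
    have [measurable]: "h \<in> borel_measurable borel" using that by auto
    show "(\<lambda>y. h y * gauss (c *\<^sub>R (z - y))) \<in> borel_measurable lborel" by measurable
    have "\<bar>h y\<bar> * gauss (c *\<^sub>R (z - y)) \<le> \<bar>h y\<bar> * gauss (0::'a)" for y
      by (intro mult_left_mono gauss_le) auto
    then show "AE y in lborel. norm (h y * gauss (c *\<^sub>R (z - y))) \<le> norm (gauss (0::'a) * h y)"
      by (simp add: abs_mult abs_of_nonneg[OF gauss_nonneg] mult.commute)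
  qed
  have A1: "(\<lambda>n. real (Suc n) ^ DIM('a) * (LINT y|lborel. f1 y * gauss (real (Suc n) *\<^sub>R (z - y)))) \<longlonglongrightarrow> f z"
  proof -
    have eq: "real (Suc n) ^ DIM('a) * (LINT y|lborel. f1 y * gauss (real (Suc n) *\<^sub>R (z - y)))
        = (LINT u|lborel. f1 (z - u /\<^sub>R real (Suc n)) * gauss u)" for n
    proof -
      let ?G = "\<lambda>u. f1 (z - u /\<^sub>R real (Suc n)) * gauss u"
      have "(LINT y|lborel. f1 y * gauss (real (Suc n) *\<^sub>R (z - y))) = (LINT v|lborel. f1 (z - v) * gauss (real (Suc n) *\<^sub>R (z - (z - v))))"
        by (rule lborel_integral_reflect(1)[symmetric]) measurable
      also have "\<dots> = (LINT v|lborel. ?G (real (Suc n) *\<^sub>R v))" by simp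
      also have "\<dots> = (LINT u|lborel. ?G u) / real (Suc n) ^ DIM('a)"
        by (rule integral_scaleR) (simp, measurable)
      finally show ?thesis by simp
    qed
    have "(\<lambda>n. LINT u|lborel. f1 (z - u /\<^sub>R real (Suc n)) * gauss u) \<longlonglongrightarrow> (LINT u|lborel. f z * gauss (u::'a))"
    proof (rule integral_dominated_convergence)
      show "integrable lborel (\<lambda>u::'a. (\<bar>f z\<bar> + 1) * gauss u)" by (simp add: integrable_gauss)
      show "AE u in lborel. norm (f1 (z - u /\<^sub>R real (Suc n)) * gauss u) \<le> (\<bar>f z\<bar> + 1) * gauss u" for n
        by (intro AE_I2) (simp add: abs_mult abs_of_nonneg[OF gauss_nonneg] mult_right_mono f1 gauss_nonneg)
      have "(\<lambda>n. f1 (z - u /\<^sub>R real (Suc n))) \<longlonglongrightarrow> f z" for u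
      proof -
        have lim: "(\<lambda>n. z - u /\<^sub>R real (Suc n)) \<longlonglongrightarrow> z - 0 *\<^sub>R u"
          by (intro tendsto_intros LIMSEQ_inverse_real_of_nat)
        then have "(\<lambda>n. f (z - u /\<^sub>R real (Suc n))) \<longlonglongrightarrow> f z"
          using isCont_tendsto_compose[OF cont] by simp
        moreover have "eventually (\<lambda>n. z - u /\<^sub>R real (Suc n) \<in> ball z \<delta>) sequentially"
          using topological_tendstoD[OF lim, of "ball z \<delta>"] \<delta>(1) by simp
        then have "eventually (\<lambda>n. f (z - u /\<^sub>R real (Suc n)) = f1 (z - u /\<^sub>R real (Suc n))) sequentially"
          by eventually_elim (simp add: f1_def)
        ultimately show ?thesis by (rule Lim_transform_eventually)
      qed
      then show "AE u in lborel. (\<lambda>n. f1 (z - u /\<^sub>R real (Suc n)) * gauss u) \<longlonglongrightarrow> f z * gauss u"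
        by (intro AE_I2 tendsto_mult tendsto_const)
    qed measurable
    then show ?thesis unfolding eq by (simp add: integral_gauss)
  qed
  have A2: "(\<lambda>n. real (Suc n) ^ DIM('a) * (LINT y|lborel. f2 y * gauss (real (Suc n) *\<^sub>R (z - y)))) \<longlonglongrightarrow> 0"
  proof (rule Lim_null_comparison)
    let ?K = "gauss (0::'a) * (LINT y|lborel. \<bar>f y\<bar>)"
    show "(\<lambda>n. ?K * (real (Suc n) ^ DIM('a) * exp (- (real (Suc n) * \<delta>)\<^sup>2 / 2))) \<longlonglongrightarrow> 0"
      using tendsto_mult_left[OF power_times_gaussian_tendsto_0[OF \<delta>(1)], of ?K] by simp
    show "eventually (\<lambda>n. norm (real (Suc n) ^ DIM('a) * (LINT y|lborel. f2 y * gauss (real (Suc n) *\<^sub>R (z - y))))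
        \<le> ?K * (real (Suc n) ^ DIM('a) * exp (- (real (Suc n) * \<delta>)\<^sup>2 / 2))) sequentially"
    proof (rule always_eventually, rule allI)
      fix n
      let ?s = "real (Suc n)" and ?E = "exp (- (real (Suc n) * \<delta>)\<^sup>2 / 2)"
      have b: "\<bar>f2 y * gauss (?s *\<^sub>R (z - y))\<bar> \<le> gauss (0::'a) * ?E * \<bar>f y\<bar>" for y
      proof (cases "dist z y < \<delta>")
        case True
        then show ?thesis using f2(2)[of y] gauss_nonneg[of "0::'a"] by simp
      next
        case False
        then have "?s * \<delta> \<le> norm (?s *\<^sub>R (z - y))"
          by (simp add: dist_norm)
        then have "(?s * \<delta>)\<^sup>2 \<le> (norm (?s *\<^sub>R (z - y)))\<^sup>2"
          using \<delta>(1) by (intro power_mono) auto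
        then have "exp (- (norm (?s *\<^sub>R (z - y)))\<^sup>2 / 2) \<le> ?E" by simp
        then have "gauss (?s *\<^sub>R (z - y)) \<le> gauss (0::'a) * ?E"
          unfolding gauss_eq by (simp add: mult_left_mono)
        then have "\<bar>f2 y\<bar> * gauss (?s *\<^sub>R (z - y)) \<le> \<bar>f y\<bar> * (gauss (0::'a) * ?E)"
          using f2(1)[of y] by (intro mult_mono) (auto simp: gauss_nonneg)
        then show ?thesis by (simp add: abs_mult abs_of_nonneg[OF gauss_nonneg] mult_ac)
      qed
      have "\<bar>LINT y|lborel. f2 y * gauss (?s *\<^sub>R (z - y))\<bar> \<le> (LINT y|lborel. \<bar>f2 y * gauss (?s *\<^sub>R (z - y))\<bar>)"
        by (rule integral_abs_bound)
      also have "\<dots> \<le> (LINT y|lborel. gauss (0::'a) * ?E * \<bar>f y\<bar>)"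
        using ig[OF i2] f b by (intro integral_mono) auto
      also have "\<dots> = ?K * ?E" by simp
      finally have "?s ^ DIM('a) * \<bar>LINT y|lborel. f2 y * gauss (?s *\<^sub>R (z - y))\<bar> \<le> ?s ^ DIM('a) * (?K * ?E)"
        by (intro mult_left_mono) auto
      then show "norm (?s ^ DIM('a) * (LINT y|lborel. f2 y * gauss (?s *\<^sub>R (z - y)))) \<le> ?K * (?s ^ DIM('a) * ?E)"
        by (simp add: abs_mult mult_ac)
    qed
  qed
  have "f y = f1 y + f2 y" for y by (simp add: f2_def)
  then have "real (Suc n) ^ DIM('a) * (LINT y|lborel. f y * gauss (real (Suc n) *\<^sub>R (z - y)))
     = real (Suc n) ^ DIM('a) * (LINT y|lborel. f1 y * gauss (real (Suc n) *\<^sub>R (z - y)))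
     + real (Suc n) ^ DIM('a) * (LINT y|lborel. f2 y * gauss (real (Suc n) *\<^sub>R (z - y)))" for n
    using ig[OF i1] ig[OF i2] by (simp add: distrib_right distrib_left)
  with tendsto_add[OF A1 A2] show ?thesis by simp
qed

text \<open>The Gaussian is rewritten as its own cosine integral, Fubini moves the frequency
  outside, and the addition formula splits off \<open>z\<close>; the sine part vanishes because
  \<open>f\<close> is even. The integrability clause later allows finite sums over pairs of points
  to be exchanged with the integral.\<close>

lemma integral_mult_gauss:
  fixes f :: "'a::euclidean_space \<Rightarrow> real"
  assumes f: "integrable lborel f" and even: "\<And>y. f (- y) = f y"
  shows "(LINT y|lborel. f y * gauss (s *\<^sub>R (z - y)))
    = gauss (0::'a) * (LINT \<xi>|lborel. gauss \<xi> * (cos (s * (\<xi> \<bullet> z)) * (LINT y|lborel. f y * cos (s * (\<xi> \<bullet> y)))))"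
    and "integrable lborel (\<lambda>\<xi>. gauss \<xi> * (cos (s * (\<xi> \<bullet> z)) * (LINT y|lborel. f y * cos (s * (\<xi> \<bullet> y)))))"
proof -
  have [measurable]: "f \<in> borel_measurable borel" using f by auto
  have ftrig: "integrable lborel (\<lambda>y. f y * cos (s * (\<xi> \<bullet> y)))" "integrable lborel (\<lambda>y. f y * sin (s * (\<xi> \<bullet> y)))" for \<xi>
    by (rule Bochner_Integration.integrable_bound[OF f]; auto simp: abs_mult intro!: mult_left_le)+
  have g0: "gauss v = gauss (0::'a) * (LINT \<xi>|lborel. gauss \<xi> * cos (\<xi> \<bullet> v))" for v :: 'a
    unfolding integral_gauss_cos by (simp add: gauss_eq)
  define h where "h y \<xi> = gauss \<xi> * (f y * cos (\<xi> \<bullet> (s *\<^sub>R (z - y))))" for y \<xi>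
  have hm: "(\<lambda>(y, \<xi>). h y \<xi>) \<in> borel_measurable (lborel \<Otimes>\<^sub>M lborel)" unfolding h_def by measurable
  have hi: "integrable (lborel \<Otimes>\<^sub>M lborel) (\<lambda>(y, \<xi>). h y \<xi>)"
  proof (rule Bochner_Integration.integrable_bound[OF integrable_lborel_times[OF f integrable_gauss] hm])
    have "\<bar>gauss \<xi>\<bar> * (\<bar>f y\<bar> * \<bar>cos (\<xi> \<bullet> (s *\<^sub>R (z - y)))\<bar>) \<le> \<bar>gauss \<xi>\<bar> * (\<bar>f y\<bar> * 1)" for y \<xi>
      by (intro mult_left_mono) auto
    then show "AE p in lborel \<Otimes>\<^sub>M lborel. norm (case p of (y, \<xi>) \<Rightarrow> h y \<xi>) \<le> norm (case p of (y, \<xi>) \<Rightarrow> f y * gauss \<xi>)"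
      unfolding h_def by (auto simp: abs_mult mult.commute)
  qed
  have inner: "(LINT y|lborel. h y \<xi>) = gauss \<xi> * (cos (s * (\<xi> \<bullet> z)) * (LINT y|lborel. f y * cos (s * (\<xi> \<bullet> y))))" for \<xi>
  proof -
    have "(LINT y|lborel. f (0 - y) * sin (s * (\<xi> \<bullet> (0 - y)))) = (LINT y|lborel. f y * sin (s * (\<xi> \<bullet> y)))"
      by (rule lborel_integral_reflect) measurable
    then have odd: "(LINT y|lborel. f y * sin (s * (\<xi> \<bullet> y))) = 0" by (simp add: even)
    have "h y \<xi> = gauss \<xi> * (cos (s * (\<xi> \<bullet> z)) * (f y * cos (s * (\<xi> \<bullet> y))) + sin (s * (\<xi> \<bullet> z)) * (f y * sin (s * (\<xi> \<bullet> y))))" for y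
      unfolding h_def by (simp add: inner_diff_right right_diff_distrib cos_diff algebra_simps)
    then have "(LINT y|lborel. h y \<xi>) = gauss \<xi> * (cos (s * (\<xi> \<bullet> z)) * (LINT y|lborel. f y * cos (s * (\<xi> \<bullet> y)))
        + sin (s * (\<xi> \<bullet> z)) * (LINT y|lborel. f y * sin (s * (\<xi> \<bullet> y))))"
      using ftrig[of \<xi>] by simp
    then show ?thesis unfolding odd by simp
  qed
  have "(LINT y|lborel. f y * gauss (s *\<^sub>R (z - y))) = (LINT y|lborel. gauss (0::'a) * (LINT \<xi>|lborel. h y \<xi>))"
    unfolding h_def by (subst g0) (simp add: mult.left_commute[of "gauss _" "f _"])
  also have "\<dots> = gauss (0::'a) * (LINT \<xi>|lborel. LINT y|lborel. h y \<xi>)"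
    using lborel_pair.Fubini_integral[OF hi] by simp
  finally show "(LINT y|lborel. f y * gauss (s *\<^sub>R (z - y)))
    = gauss (0::'a) * (LINT \<xi>|lborel. gauss \<xi> * (cos (s * (\<xi> \<bullet> z)) * (LINT y|lborel. f y * cos (s * (\<xi> \<bullet> y)))))"
    unfolding inner .
  show "integrable lborel (\<lambda>\<xi>. gauss \<xi> * (cos (s * (\<xi> \<bullet> z)) * (LINT y|lborel. f y * cos (s * (\<xi> \<bullet> y)))))"
    using lborel_pair.integrable_snd[OF hi] unfolding inner .
qed

text \<open>With this, a hypothesis on the form at single vectors controls all pairs of the
  \<alpha>, for any scalar coefficients.\<close>

lemma quadratic_form_sum:
  fixes A :: "real ^ 'd ^ 'd"
  shows "(\<Sum>a<N. c a *\<^sub>R \<alpha> a) \<bullet> (A *v (\<Sum>b<N. c b *\<^sub>R \<alpha> b))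
    = (\<Sum>a<N. \<Sum>b<N. c a * c b * (\<alpha> a \<bullet> (A *v \<alpha> (b::nat))))"
proof -
  have "A *v (\<Sum>b<N. c b *\<^sub>R \<alpha> b) = (\<Sum>b<N. c b *\<^sub>R (A *v \<alpha> b))"
    by (simp add: linear_sum[OF matrix_vector_mul_linear] matrix_vector_mult_scaleR)
  then show ?thesis
    by (subst sum.swap) (simp add: inner_sum_left inner_sum_right sum_distrib_left mult_ac)
qed

lemma bounded_linear_matrix_form: "bounded_linear (\<lambda>A::real ^ 'd ^ 'd. v \<bullet> (A *v w))"
  by (intro linear_conv_bounded_linear[THEN iffD1] linearI)
    (auto simp: matrix_vector_mult_add_rdistrib inner_add_right scaleR_matrix_vector_assoc[symmetric])

text \<open>After mollification the sum over pairs is a frequency integral of cos(s \<xi> \<bullet>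
  (x a - x b)) times transforms. The addition formula turns the integrand into two values of the
  quadratic form of the transform, at the sum of the vectors cos(s \<xi> \<bullet> x a) \<alpha> a
  and at its sine analogue. Both are nonnegative for nonzero \<xi>; the origin, which has no
  direction, is a null set.\<close>

theorem positive_definite_of_fourier_nonneg:
  fixes k :: "real ^ 'd \<Rightarrow> real ^ 'd ^ 'd"
  assumes int: "integrable lborel k" and cont: "continuous_on UNIV k" and even: "\<And>x. k (- x) = k x"
    and nonneg: "\<And>\<eta> w. \<eta> \<noteq> 0 \<Longrightarrow> 0 \<le> (LINT y|lborel. (w \<bullet> (k y *v w)) * cos (y \<bullet> \<eta>))"
  shows "positive_definite k"
  unfolding positive_definite_def
proof (intro allI)
  fix N and x \<alpha> :: "nat \<Rightarrow> real ^ 'd"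
  define f where "f a b y = \<alpha> a \<bullet> (k y *v \<alpha> b)" for a b y
  have fi: "integrable lborel (f a b)" for a b
    unfolding f_def[abs_def] by (rule integrable_bounded_linear[OF bounded_linear_matrix_form int])
  have fe: "f a b (- y) = f a b y" for a b y by (simp add: f_def even)
  have fc: "isCont (f a b) z" for a b z
  proof -
    have "isCont k z" using cont by (simp add: continuous_on_eq_continuous_at)
    then show ?thesis unfolding f_def[abs_def]
      by (rule bounded_linear.isCont[OF bounded_linear_matrix_form])
  qed
  define F where "F s a b \<xi> = (LINT y|lborel. f a b y * cos (s * (\<xi> \<bullet> y)))" for s a b and \<xi> :: "real ^ 'd"
  have pos: "0 \<le> (\<Sum>a<N. \<Sum>b<N. LINT y|lborel. f a b y * gauss (s *\<^sub>R (x a - x b - y)))" if s: "s > 0" for s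
  proof -
    have Fpos: "0 \<le> (\<Sum>a<N. \<Sum>b<N. c a * c b * F s a b \<xi>)" if "\<xi> \<noteq> 0" for c and \<xi> :: "real ^ 'd"
    proof -
      have I: "integrable lborel (\<lambda>y. f a b y * cos (s * (\<xi> \<bullet> y)))" for a b
        using fi[of a b] by (rule Bochner_Integration.integrable_bound)
          (use fi[of a b] in \<open>auto simp: abs_mult intro!: mult_left_le\<close>)
      have "0 \<le> (LINT y|lborel. ((\<Sum>a<N. c a *\<^sub>R \<alpha> a) \<bullet> (k y *v (\<Sum>b<N. c b *\<^sub>R \<alpha> b))) * cos (y \<bullet> (s *\<^sub>R \<xi>)))"
        using that s by (intro nonneg) simp
      also have "\<dots> = (LINT y|lborel. (\<Sum>a<N. \<Sum>b<N. c a * c b * (f a b y * cos (s * (\<xi> \<bullet> y)))))"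
        unfolding quadratic_form_sum f_def by (simp add: sum_distrib_right mult.assoc inner_commute)
      also have "\<dots> = (\<Sum>a<N. \<Sum>b<N. c a * c b * F s a b \<xi>)"
        unfolding F_def using I by (simp add: Bochner_Integration.integral_sum)
      finally show ?thesis .
    qed
    note G = integral_mult_gauss[OF fi fe]
    have "(\<Sum>a<N. \<Sum>b<N. LINT y|lborel. f a b y * gauss (s *\<^sub>R (x a - x b - y)))
       = gauss (0 :: real ^ 'd) * (LINT \<xi>|lborel. (\<Sum>a<N. \<Sum>b<N. gauss \<xi> * (cos (s * (\<xi> \<bullet> (x a - x b))) * F s a b \<xi>)))"
      unfolding G(1) F_def using G(2) by (simp add: Bochner_Integration.integral_sum sum_distrib_left)
    also have "\<dots> \<ge> 0"
    proof (intro mult_nonneg_nonneg gauss_nonneg integral_nonneg_AE)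
      show "AE \<xi> in lborel. 0 \<le> (\<Sum>a<N. \<Sum>b<N. gauss \<xi> * (cos (s * (\<xi> \<bullet> (x a - x b))) * F s a b \<xi>))"
        using AE_lborel_singleton[of "0 :: real ^ 'd"]
      proof eventually_elim
        case (elim \<xi>)
        let ?c = "\<lambda>a. cos (s * (\<xi> \<bullet> x a))" and ?s = "\<lambda>a. sin (s * (\<xi> \<bullet> x a))"
        have "(\<Sum>a<N. \<Sum>b<N. gauss \<xi> * (cos (s * (\<xi> \<bullet> (x a - x b))) * F s a b \<xi>))
           = gauss \<xi> * ((\<Sum>a<N. \<Sum>b<N. ?c a * ?c b * F s a b \<xi>) + (\<Sum>a<N. \<Sum>b<N. ?s a * ?s b * F s a b \<xi>))"
          by (simp add: inner_diff_right right_diff_distrib cos_diff distrib_right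
              flip: sum.distrib sum_distrib_left)
        also have "\<dots> \<ge> 0" using elim by (intro mult_nonneg_nonneg gauss_nonneg add_nonneg_nonneg Fpos)
        finally show ?case .
      qed
    qed
    finally show ?thesis .
  qed
  \<comment> \<open>The factor (n + 1)^d gives the dilated Gaussian total mass 1.\<close>
  have "(\<lambda>n. \<Sum>a<N. \<Sum>b<N. real (Suc n) ^ DIM(real ^ 'd) * (LINT y|lborel. f a b y * gauss (real (Suc n) *\<^sub>R (x a - x b - y))))
     \<longlonglongrightarrow> (\<Sum>a<N. \<Sum>b<N. f a b (x a - x b))"
    by (intro tendsto_sum gauss_approximate_identity fi fc)
  moreover have "0 \<le> (\<Sum>a<N. \<Sum>b<N. real (Suc n) ^ DIM(real ^ 'd) * (LINT y|lborel. f a b y * gauss (real (Suc n) *\<^sub>R (x a - x b - y))))" for n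
    unfolding sum_distrib_left[symmetric] using pos[of "real (Suc n)"] by simp
  ultimately have "0 \<le> (\<Sum>a<N. \<Sum>b<N. f a b (x a - x b))"
    by (intro LIMSEQ_le_const) auto
  then show "0 \<le> (\<Sum>a<N. \<Sum>b<N. \<alpha> a \<bullet> (k (x a - x b) *v \<alpha> b))" by (simp add: f_def)
qed

section \<open>Radial matrix-valued functions\<close>

text \<open>An orthogonal map carries a basis vector to the direction of \<xi>. It preserves
  Lebesgue measure, norms and inner products, so pulling \<open>w\<close> back through it reduces
  the claim to \<open>fourier_quadratic_axis\<close>.\<close>

lemma fourier_quadratic:
  fixes \<xi> w :: "real ^ 'd" and p q :: "real \<Rightarrow> real"
  assumes dim: "CARD('d) \<ge> 2" and \<xi>: "\<xi> \<noteq> 0" and \<mu>: "\<mu> = real CARD('d) / 2 - 1"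
    and [measurable]: "p \<in> borel_measurable borel" "q \<in> borel_measurable borel"
    and ip: "integrable lborel (\<lambda>x::real ^ 'd. p (norm x))" and iq: "integrable lborel (\<lambda>x::real ^ 'd. q (norm x))"
  shows "(LINT x|lborel. (q (norm x) * (norm w)\<^sup>2 + (p (norm x) - q (norm x)) * (w \<bullet> sgn x)\<^sup>2) * cos (2 * pi * (x \<bullet> \<xi>)))
    = (2 * pi / norm \<xi> powr \<mu> * hankel \<mu> (\<mu> + 1) (norm \<xi>) p
        - (2 * \<mu> + 1) / norm \<xi> powr (\<mu> + 1) * hankel (\<mu> + 1) \<mu> (norm \<xi>) (\<lambda>r. p r - q r)) * (w \<bullet> sgn \<xi>)\<^sup>2
    + (2 * pi / norm \<xi> powr \<mu> * hankel \<mu> (\<mu> + 1) (norm \<xi>) q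
        + 1 / norm \<xi> powr (\<mu> + 1) * hankel (\<mu> + 1) \<mu> (norm \<xi>) (\<lambda>r. p r - q r)) * ((norm w)\<^sup>2 - (w \<bullet> sgn \<xi>)\<^sup>2)"
proof -
  let ?\<rho> = "norm \<xi>"
  obtain e :: "real ^ 'd" where e: "e \<in> Basis" using nonempty_Basis by blast
  have "norm e = norm (sgn \<xi>)" using e \<xi> by (simp add: norm_sgn)
  then obtain f where f: "orthogonal_transformation f" "f e = sgn \<xi>"
    by (rule orthogonal_transformation_exists)
  obtain w' where w': "w = f w'" using orthogonal_transformation_surj[OF f(1)] by (auto simp: surj_def)
  have inner: "f x \<bullet> f y = x \<bullet> y" for x y using f(1) by (simp add: orthogonal_transformation_def)
  have nf: "norm (f x) = norm x" for x using f(1) by (rule orthogonal_transformation_norm)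
  have sf: "sgn (f x) = f (sgn x)" for x by (simp add: sgn_div_norm nf orthogonal_transformation_scaleR[OF f(1)])
  have \<xi>f: "f x \<bullet> \<xi> = ?\<rho> * (x \<bullet> e)" for x
  proof -
    have "\<xi> = ?\<rho> *\<^sub>R f e" using \<xi> by (simp add: f(2) sgn_div_norm)
    then have "f x \<bullet> \<xi> = ?\<rho> * (f x \<bullet> f e)" by (metis inner_scaleR_right)
    then show ?thesis by (simp add: inner)
  qed
  have "(LINT x|lborel. (q (norm x) * (norm w)\<^sup>2 + (p (norm x) - q (norm x)) * (w \<bullet> sgn x)\<^sup>2) * cos (2 * pi * (x \<bullet> \<xi>)))
    = (LINT x|lborel. (q (norm (f x)) * (norm w)\<^sup>2 + (p (norm (f x)) - q (norm (f x))) * (w \<bullet> sgn (f x))\<^sup>2) * cos (2 * pi * (f x \<bullet> \<xi>)))"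
    by (rule integral_orthogonal[OF f(1), symmetric]) measurable
  also have "\<dots> = (LINT x|lborel. (q (norm x) * (norm w')\<^sup>2 + (p (norm x) - q (norm x)) * (w' \<bullet> sgn x)\<^sup>2) * cos (2 * pi * ?\<rho> * (x \<bullet> e)))"
    unfolding w' sf nf \<xi>f inner by (simp only: mult.assoc)
  also note fourier_quadratic_axis[where w = w' and p = p and q = q and \<mu> = \<mu> and \<rho> = ?\<rho> and e = e]
  finally show ?thesis
    using dim e \<xi> \<mu> ip iq by (simp add: w' nf inner f(2)[symmetric])
qed

text \<open>This includes x = 0: division by zero makes \<open>proj_par 0\<close> the zero matrix,
  and \<open>sgn 0 = 0\<close>.\<close>

lemma proj_par_form: "v \<bullet> (proj_par x *v w) = (v \<bullet> sgn x) * (w \<bullet> sgn x)"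
proof -
  have "(\<chi> i j. x $ i * x $ j) *v w = (w \<bullet> x) *\<^sub>R x"
    by (simp add: vec_eq_iff matrix_vector_mult_def inner_vec_def sum_distrib_left mult_ac)
  then show ?thesis
    unfolding proj_par_def
    by (simp add: scaleR_matrix_vector_assoc[symmetric] sgn_div_norm power2_eq_square divide_inverse mult_ac)
qed

text \<open>Separates an isotropic term from a single anisotropic one with coefficient a - b; this
  is the origin of the difference \<open>kpar r - kperp r\<close> in the formulas.\<close>

lemma radial_form:
  "w \<bullet> ((a *\<^sub>R proj_par x + b *\<^sub>R proj_perp x) *v w) = b * (norm w)\<^sup>2 + (a - b) * (w \<bullet> sgn x)\<^sup>2"
  unfolding proj_perp_def
  by (simp add: matrix_vector_mult_add_rdistrib matrix_vector_mult_diff_rdistrib inner_add_right inner_diff_right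
    scaleR_matrix_vector_assoc[symmetric] proj_par_form power2_norm_eq_inner)
    (simp add: power2_eq_square algebra_simps)

lemma transpose_radial: "transpose (a *\<^sub>R proj_par x + b *\<^sub>R proj_perp x) = a *\<^sub>R proj_par x + b *\<^sub>R proj_perp x"
  by (simp add: vec_eq_iff transpose_def proj_perp_def proj_par_def mat_def mult.commute eq_commute)

section \<open>From Lebesgue to Borel measurability\<close>

lemma measurable_lebesgue_AE:
  fixes f g :: "'a::euclidean_space \<Rightarrow> real"
  assumes f: "f \<in> borel_measurable lebesgue" and ae: "AE x in lborel. f x = g x"
  shows "g \<in> borel_measurable lebesgue"
proof (rule measurableI)
  fix A :: "real set" assume A: "A \<in> sets borel"
  have eq: "AE x in lebesgue. x \<in> f -` A \<longleftrightarrow> x \<in> g -` A"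
    using AE_completion[OF ae] by eventually_elim auto
  have "f -` A \<in> sets lebesgue" using measurable_sets[OF f A] by simp
  from completion.in_sets_AE[OF eq this]
  show "g -` A \<inter> space lebesgue \<in> sets lebesgue" by simp
qed simp

text \<open>\<open>F\<close> inherits Lebesgue measurability from the Borel function
  \<open>G\<close>, because the completed measure contains every subset of a null set.\<close>

lemma set_integral_lebesgue_eq:
  fixes F G :: "real \<Rightarrow> real"
  assumes ae: "AE r in lborel. r > 0 \<longrightarrow> F r = G r" and [measurable]: "G \<in> borel_measurable borel"
  shows "(LINT r:{0<..}|lebesgue. F r) = (LINT r|lborel. indicator {0<..} r * G r)"
proof -
  have m: "(\<lambda>r. indicator {0<..} r * G r) \<in> borel_measurable lborel" by measurable
  then have m': "(\<lambda>r. indicator {0<..} r * G r) \<in> borel_measurable lebesgue" by (rule measurable_completion)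
  have eq: "AE r in lborel. indicator {0<..} r * G r = indicator {0<..} r *\<^sub>R F r"
    using ae by eventually_elim (auto split: split_indicator)
  have "(LINT r:{0<..}|lebesgue. F r) = (LINT r|lebesgue. indicator {0<..} r * G r)"
    unfolding set_lebesgue_integral_def
    using AE_completion[OF eq]
    by (intro integral_cong_AE measurable_lebesgue_AE[OF m' eq] m') (auto elim: eventually_mono)
  also have "\<dots> = (LINT r|lborel. indicator {0<..} r * G r)"
    by (rule integral_completion[OF m])
  finally show ?thesis .
qed

text \<open>The Borel profile agrees with \<open>f\<close> in two senses: almost everywhere in the
  radius, for the Hankel integrals, and almost everywhere in space, for the Fourier integrals. The
  origin, where \<open>F\<close> is unconstrained, is a null set.\<close>

lemma radial_profile:
  fixes f :: "real \<Rightarrow> real" and F :: "'a::euclidean_space \<Rightarrow> real"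
  assumes F: "integrable lebesgue F" and eq: "\<And>x. x \<noteq> 0 \<Longrightarrow> F x = f (norm x)"
  obtains p where "p \<in> borel_measurable borel" "AE r in lborel. r > 0 \<longrightarrow> f r = p r"
    "AE x in lborel. f (norm (x::'a)) = p (norm x)" "integrable lborel (\<lambda>x::'a. p (norm x))"
proof -
  have ae: "AE x in lborel. F x = f (norm x)"
    using AE_lborel_singleton[of "0::'a"] by eventually_elim (simp add: eq)
  have fm: "(\<lambda>x::'a. f (norm x)) \<in> borel_measurable lebesgue"
    by (rule measurable_lebesgue_AE[OF borel_measurable_integrable[OF F] ae])
  obtain p where p: "p \<in> borel_measurable borel" "AE r in lborel. r > 0 \<longrightarrow> f r = p r"
    using radial_borel_representative[OF fm] by blast
  have ae2: "AE x in lborel. f (norm (x::'a)) = p (norm x)" by (rule AE_norm[OF p(2)])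
  have pm: "(\<lambda>x::'a. p (norm x)) \<in> borel_measurable lborel" using p(1) by measurable
  have "AE x in lebesgue. F x = p (norm x)"
    using AE_completion[OF ae] AE_completion[OF ae2] by eventually_elim simp
  then have "integrable lebesgue (\<lambda>x::'a. p (norm x))"
    using F integrable_cong_AE[OF borel_measurable_integrable[OF F] measurable_completion[OF pm]] by blast
  then have "integrable lborel (\<lambda>x::'a. p (norm x))" by (simp add: integrable_completion[OF pm])
  then show ?thesis using that p ae2 by blast
qed

theorem corollary3p12:
  fixes k :: "real ^ 'd \<Rightarrow> real ^ 'd ^ 'd"
    and kpar kperp hpar hperp :: "real \<Rightarrow> real"
    and \<mu> :: real
  assumes dim: "CARD('d) \<ge> 2"
    and L1: "integrable lebesgue k"
    and form: "\<And>x. x \<noteq> 0 \<Longrightarrow>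
      k x = kpar (norm x) *\<^sub>R proj_par x + kperp (norm x) *\<^sub>R proj_perp x"
    and mu: "\<mu> = real CARD('d) / 2 - 1"
    and hpar: "\<And>\<rho>. \<rho> > 0 \<Longrightarrow> hpar \<rho> =
      2 * pi / \<rho> powr \<mu> *
        (LINT r:{0<..}|lebesgue. r powr (\<mu> + 1) * kpar r * bessel_J \<mu> (2 * pi * \<rho> * r))
      - (2 * \<mu> + 1) / \<rho> powr (\<mu> + 1) *
        (LINT r:{0<..}|lebesgue. r powr \<mu> * (kpar r - kperp r) * bessel_J (\<mu> + 1) (2 * pi * \<rho> * r))"
    and hperp: "\<And>\<rho>. \<rho> > 0 \<Longrightarrow> hperp \<rho> =
      2 * pi / \<rho> powr \<mu> *
        (LINT r:{0<..}|lebesgue. r powr (\<mu> + 1) * kperp r * bessel_J \<mu> (2 * pi * \<rho> * r))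
      + 1 / \<rho> powr (\<mu> + 1) *
        (LINT r:{0<..}|lebesgue. r powr \<mu> * (kpar r - kperp r) * bessel_J (\<mu> + 1) (2 * pi * \<rho> * r))"
  shows "(positive_definite k \<longrightarrow> (\<forall>\<rho>>0. hpar \<rho> \<ge> 0 \<and> hperp \<rho> \<ge> 0)) \<and>
    (continuous_on UNIV k \<longrightarrow>
      (positive_definite k \<longleftrightarrow> (\<forall>\<rho>>0. hpar \<rho> \<ge> 0 \<and> hperp \<rho> \<ge> 0)) \<and>
      (is_kernel (\<lambda>x y. k (x - y)) \<longleftrightarrow> (\<forall>\<rho>>0. hpar \<rho> \<ge> 0 \<and> hperp \<rho> \<ge> 0)))"
proof -
  have form_quad: "w \<bullet> (k x *v w) = kperp (norm x) * (norm w)\<^sup>2 + (kpar (norm x) - kperp (norm x)) * (w \<bullet> sgn x)\<^sup>2"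
    if "x \<noteq> 0" for x w
    unfolding form[OF that] by (rule radial_form)
  have entry: "integrable lebesgue (\<lambda>x. v \<bullet> (k x *v w))" for v w
    by (rule integrable_bounded_linear[OF bounded_linear_matrix_form L1])
  \<comment> \<open>In the radial direction the transverse part drops out, so this form recovers
    \<open>kpar\<close> and hands it the integrability of \<open>k\<close>.\<close>
  define A where "A x = sgn x \<bullet> (k x *v sgn x)" for x
  have entry_eq: "axis i 1 \<bullet> (M *v axis j 1) = M $ i $ j" for M :: "real ^ 'd ^ 'd" and i j
    by (simp add: inner_axis' matrix_vector_mult_basis column_def)
  \<comment> \<open>Each summand is an integrable entry of \<open>k\<close> times a factor bounded
    by 1.\<close>
  have A_sum: "A x = (\<Sum>i\<in>UNIV. \<Sum>j\<in>UNIV. (axis i 1 \<bullet> (k x *v axis j 1)) * (sgn x $ i * sgn x $ j))" for x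
    unfolding A_def entry_eq by (simp add: inner_vec_def matrix_vector_mult_def sum_distrib_left mult_ac)
  have iA: "integrable lebesgue A"
    unfolding A_sum[abs_def]
  proof (intro Bochner_Integration.integrable_sum)
    fix i j
    show "integrable lebesgue (\<lambda>x. (axis i 1 \<bullet> (k x *v axis j 1)) * (sgn x $ i * sgn x $ j))"
    proof (rule Bochner_Integration.integrable_bound[OF entry[of "axis i 1" "axis j 1"]])
      have "(\<lambda>x::real ^ 'd. sgn x $ i * sgn x $ j) \<in> borel_measurable lborel"
        by (simp add: cart_eq_inner_axis)
      then have "(\<lambda>x::real ^ 'd. sgn x $ i * sgn x $ j) \<in> borel_measurable lebesgue"
        by (rule measurable_completion)
      then show "(\<lambda>x. (axis i 1 \<bullet> (k x *v axis j 1)) * (sgn x $ i * sgn x $ j)) \<in> borel_measurable lebesgue"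
        by (rule borel_measurable_times[OF borel_measurable_integrable[OF entry]])
      have "\<bar>sgn x $ i\<bar> * \<bar>sgn x $ j\<bar> \<le> 1 * 1" for x :: "real ^ 'd"
        using component_le_norm_cart[of "sgn x" i] component_le_norm_cart[of "sgn x" j] norm_sgn_le[of x]
        by (intro mult_mono) auto
      then show "AE x in lebesgue. norm ((axis i 1 \<bullet> (k x *v axis j 1)) * (sgn x $ i * sgn x $ j))
         \<le> norm (axis i 1 \<bullet> (k x *v axis j 1))"
        by (intro AE_I2) (simp add: abs_mult mult_left_le)
    qed
  qed
  have A_eq: "A x = kpar (norm x)" if "x \<noteq> 0" for x
  proof -
    have "sgn x \<bullet> sgn x = 1" using that by (simp add: power2_norm_eq_inner[symmetric] norm_sgn)
    then show ?thesis unfolding A_def form_quad[OF that] using that by (simp add: norm_sgn)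
  qed
  \<comment> \<open>The trace of \<open>k x\<close> is kpar + (d - 1) kperp. Removing the radial
    part and dividing by d - 1, which is positive since d is at least 2, isolates
    \<open>kperp\<close>.\<close>
  define B where "B x = ((\<Sum>i\<in>UNIV. axis i 1 \<bullet> (k x *v axis i 1)) - A x) / (real CARD('d) - 1)" for x
  have iB: "integrable lebesgue B"
    unfolding B_def[abs_def] using iA entry by auto
  have B_eq: "B x = kperp (norm x)" if "x \<noteq> 0" for x
  proof -
    have "(\<Sum>i\<in>UNIV. (axis i 1 \<bullet> sgn x)\<^sup>2) = sgn x \<bullet> sgn x"
      unfolding inner_axis' by (simp add: inner_vec_def power2_eq_square)
    then have 1: "(\<Sum>i\<in>UNIV. (axis i 1 \<bullet> sgn x)\<^sup>2) = 1" using that by (simp add: power2_norm_eq_inner[symmetric] norm_sgn)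
    have "(\<Sum>i\<in>UNIV. axis i 1 \<bullet> (k x *v axis i 1)) = real CARD('d) * kperp (norm x) + (kpar (norm x) - kperp (norm x))"
      unfolding form_quad[OF that] by (simp add: sum.distrib sum_distrib_left[symmetric] 1)
    then show ?thesis using dim by (simp add: B_def A_eq[OF that] field_simps)
  qed
  obtain p where p: "p \<in> borel_measurable borel" "AE r in lborel. r > 0 \<longrightarrow> kpar r = p r"
    "AE x in lborel. kpar (norm (x::real ^ 'd)) = p (norm x)" "integrable lborel (\<lambda>x::real ^ 'd. p (norm x))"
    by (rule radial_profile[OF iA A_eq])
  obtain q where q: "q \<in> borel_measurable borel" "AE r in lborel. r > 0 \<longrightarrow> kperp r = q r"
    "AE x in lborel. kperp (norm (x::real ^ 'd)) = q (norm x)" "integrable lborel (\<lambda>x::real ^ 'd. q (norm x))"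
    by (rule radial_profile[OF iB B_eq])
  note [measurable] = p(1) q(1)
  define Q where "Q w x = q (norm x) * (norm w)\<^sup>2 + (p (norm x) - q (norm x)) * (w \<bullet> sgn x)\<^sup>2" for w x :: "real ^ 'd"
  have Q_ae: "AE x in lborel. w \<bullet> (k x *v w) = Q w x" for w
    using p(3) q(3) AE_lborel_singleton[of "0 :: real ^ 'd"]
    by eventually_elim (simp add: form_quad Q_def)
  have Qm[measurable]: "Q w \<in> borel_measurable borel" for w
    unfolding Q_def[abs_def] by measurable
  have iQ: "integrable lborel (Q w)" for w
  proof -
    have "integrable lebesgue (Q w) \<longleftrightarrow> integrable lebesgue (\<lambda>x. w \<bullet> (k x *v w))"
      using AE_completion[OF Q_ae[of w]] entry measurable_completion[of "Q w" lborel borel]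
      by (intro integrable_cong_AE) (auto elim: eventually_mono)
    then show ?thesis using entry integrable_completion[of "Q w" lborel] by simp
  qed

  have hankel_eq: "(LINT r:{0<..}|lebesgue. r powr s * g r * bessel_J \<nu> (2 * pi * \<rho> * r)) = hankel \<nu> s \<rho> g'"
    if "AE r in lborel. r > 0 \<longrightarrow> g r = g' r" and [measurable]: "g' \<in> borel_measurable borel" for g g' \<nu> s \<rho>
    unfolding hankel_def
    by (rule set_integral_lebesgue_eq) (use that(1) in \<open>auto elim: eventually_mono\<close>)
  have pq: "AE r in lborel. r > 0 \<longrightarrow> kpar r - kperp r = p r - q r"
    using p(2) q(2) by eventually_elim simp
  \<comment> \<open>\<open>hpar\<close> and \<open>hperp\<close> thus act as the eigenvalues of the
    transform along and across \<xi>; both implications are read off from this identity.\<close>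
  have h: "(LINT x|lborel. Q w x * cos (2 * pi * (x \<bullet> \<xi>)))
      = hpar (norm \<xi>) * (w \<bullet> sgn \<xi>)\<^sup>2 + hperp (norm \<xi>) * ((norm w)\<^sup>2 - (w \<bullet> sgn \<xi>)\<^sup>2)" if "\<xi> \<noteq> 0" for \<xi> w
  proof -
    have n: "norm \<xi> > 0" using that by simp
    have pqm: "(\<lambda>r. p r - q r) \<in> borel_measurable borel" by measurable
    show ?thesis
      unfolding hpar[OF n] hperp[OF n] Q_def hankel_eq[OF p(2,1)] hankel_eq[OF q(2,1)] hankel_eq[OF pq pqm]
      by (rule fourier_quadratic[OF dim that mu p(1) q(1) p(4) q(4)])
  qed

  have forward: "hpar \<rho> \<ge> 0 \<and> hperp \<rho> \<ge> 0" if pd: "positive_definite k" and \<rho>: "\<rho> > 0" for \<rho>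
  proof -
    have nonneg: "0 \<le> (LINT x|lborel. Q w x * cos (2 * pi * (x \<bullet> \<xi>)))" for w \<xi>
    proof -
      \<comment> \<open>Restricting the coefficient vectors to multiples of one fixed
        \<open>w\<close> leaves a scalar positive definite function.\<close>
      have "pos_def_fun (\<lambda>x. w \<bullet> (k x *v w))"
        unfolding pos_def_fun_def
      proof (intro allI)
        fix N x and c :: "nat \<Rightarrow> real"
        have "0 \<le> (\<Sum>a<N. \<Sum>b<N. (c a *\<^sub>R w) \<bullet> (k (x a - x b) *v (c b *\<^sub>R w)))"
          using pd unfolding positive_definite_def by (elim allE[of _ N] allE[of _ x] allE[of _ "\<lambda>a. c a *\<^sub>R w"])
        then show "0 \<le> (\<Sum>a<N. \<Sum>b<N. c a * c b * (w \<bullet> (k (x a - x b) *v w)))"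
          by (simp add: matrix_vector_mult_scaleR mult_ac)
      qed
      from pos_def_fun_fourier_nonneg[OF this Q_ae iQ, of "(2 * pi) *\<^sub>R \<xi>"] show ?thesis by simp
    qed
    \<comment> \<open>At a frequency of length \<rho> along axis i, the choice w = axis i isolates
      \<open>hpar\<close>, and w = axis j, orthogonal to the frequency, isolates
      \<open>hperp\<close>.\<close>
    obtain i :: 'd and j where ij: "i \<noteq> j"
      using dim card_le_Suc0_iff_eq[of "UNIV :: 'd set"] by auto
    let ?\<xi> = "\<rho> *\<^sub>R axis i (1::real)"
    have \<xi>: "?\<xi> \<noteq> 0" "norm ?\<xi> = \<rho>" "sgn ?\<xi> = axis i 1"
      using \<rho> by (auto simp: axis_eq_0_iff norm_axis_1 sgn_div_norm)
    have "axis i (1::real) \<bullet> axis i 1 = 1" "axis j (1::real) \<bullet> axis i 1 = 0"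
      using ij by (auto simp: inner_axis_axis)
    then show ?thesis
      using nonneg[of "axis i 1" ?\<xi>] nonneg[of "axis j 1" ?\<xi>] unfolding h[OF \<xi>(1)] \<xi>(2,3) by (simp add: norm_axis_1)
  qed

  have even: "k (- x) = k x" for x
  proof (cases "x = 0")
    case False
    have "proj_par (- x) = proj_par x" by (simp add: proj_par_def)
    then show ?thesis using False by (simp add: form proj_perp_def)
  qed simp

  have backward: "positive_definite k"
    if cont: "continuous_on UNIV k" and hn: "\<forall>\<rho>>0. hpar \<rho> \<ge> 0 \<and> hperp \<rho> \<ge> 0"
  proof (rule positive_definite_of_fourier_nonneg)
    \<comment> \<open>Continuity makes \<open>k\<close> itself Borel, so its integrability passes
      from the completed measure to \<open>lborel\<close>.\<close>
    have "k \<in> borel_measurable lborel" using cont by (simp add: borel_measurable_continuous_onI)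
    then show "integrable lborel k" using L1 by (simp add: integrable_completion)
    fix \<eta> w :: "real ^ 'd" assume \<eta>: "\<eta> \<noteq> 0"
    \<comment> \<open>Converts the plain cosine of y \<bullet> \<eta> to the convention with 2 pi
      used in \<open>h\<close>.\<close>
    define \<xi> where "\<xi> = \<eta> /\<^sub>R (2 * pi)"
    have \<xi>: "\<xi> \<noteq> 0" "\<eta> = (2 * pi) *\<^sub>R \<xi>" using \<eta> by (simp_all add: \<xi>_def)
    \<comment> \<open>Cauchy-Schwarz makes the coefficient of \<open>hperp\<close>
      nonnegative.\<close>
    have "\<bar>w \<bullet> sgn \<xi>\<bar> \<le> norm w" using Cauchy_Schwarz_ineq2[of w "sgn \<xi>"] \<xi>(1) by (simp add: norm_sgn)
    then have "(w \<bullet> sgn \<xi>)\<^sup>2 \<le> (norm w)\<^sup>2" by (simp add: abs_le_square_iff[symmetric])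
    then have "0 \<le> hpar (norm \<xi>) * (w \<bullet> sgn \<xi>)\<^sup>2 + hperp (norm \<xi>) * ((norm w)\<^sup>2 - (w \<bullet> sgn \<xi>)\<^sup>2)"
      using hn \<xi>(1) by simp
    also have "\<dots> = (LINT x|lborel. Q w x * cos (2 * pi * (x \<bullet> \<xi>)))" by (rule h[OF \<xi>(1), symmetric])
    also have "\<dots> = (LINT y|lborel. (w \<bullet> (k y *v w)) * cos (y \<bullet> \<eta>))"
    proof (rule integral_cong_AE)
      have "(\<lambda>y. w \<bullet> (k y *v w)) \<in> borel_measurable borel"
        using integrable_bounded_linear[OF bounded_linear_matrix_form \<open>integrable lborel k\<close>, of w w] by auto
      then show "(\<lambda>y. (w \<bullet> (k y *v w)) * cos (y \<bullet> \<eta>)) \<in> borel_measurable lborel" by simp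
      show "AE x in lborel. Q w x * cos (2 * pi * (x \<bullet> \<xi>)) = (w \<bullet> (k x *v w)) * cos (x \<bullet> \<eta>)"
        using Q_ae[of w] by eventually_elim (simp add: \<xi>(2))
    qed measurable
    finally show "0 \<le> (LINT y|lborel. (w \<bullet> (k y *v w)) * cos (y \<bullet> \<eta>))" .
  qed (rule cont even)+

  \<comment> \<open>The radial form gives a symmetric matrix only for nonzero x. By continuity the
    points with symmetric value form a closed set, and 0 is a limit of nonzero points, so
    \<open>k 0\<close> is symmetric as well.\<close>
  have kernel: "is_kernel (\<lambda>x y. k (x - y)) \<longleftrightarrow> positive_definite k" if cont: "continuous_on UNIV k"
  proof -
    have "closed {x. k x = transpose (k x)}"
    proof (rule closed_Collect_eq)
      show "continuous_on UNIV k" by (rule cont)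
      have "continuous_on UNIV (\<lambda>x. k x $ i $ j)" for i j
        using cont by (intro continuous_intros)
      then show "continuous_on UNIV (\<lambda>x. transpose (k x))"
        unfolding transpose_def by (intro continuous_on_vec_lambda)
    qed
    moreover have "- {0} \<subseteq> {x. k x = transpose (k x)}"
      using form by (auto simp: transpose_radial)
    ultimately have "closure (- {0}) \<subseteq> {x. k x = transpose (k x)}" by (rule closure_minimal[rotated])
    then have sym: "k x = transpose (k x)" for x
      by (auto simp: closure_complement)
    have "k (y - x) = transpose (k (x - y))" for x y
      using even[of "x - y"] sym[of "x - y"] by simp
    then show ?thesis unfolding is_kernel_def positive_definite_def by blast
  qed

  show ?thesis using forward backward kernel by blast
qed

end
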